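(* Let $p,q$ be relatively prime positive integers, let $\omega_1=\sqrt{2-\sqrt2}$ and $T_1=2\pi/\omega_1$, and let $F_1,F_2:\mathbb{R}\times\mathbb{R}^4\to\mathbb{R}$ be smooth functions $F_k(\tau,\theta_1,\theta_1',\theta_2,\theta_2')$ that are periodic in $\tau$ of period $pT_1/q$. Consider the perturbed double pendulum $$\theta_1''=-2\theta_1+\theta_2+\varepsilon F_1(\tau,\theta_1,\theta_1',\theta_2,\theta_2'),\qquad \theta_2''=2\theta_1-2\theta_2+\varepsilon F_2(\tau,\theta_1,\theta_1',\theta_2,\theta_2'),$$ and let $\mathcal G_1,\mathcal G_2:\mathbb{R}^2\to\mathbb{R}$ be the functions defined in the context from $F_1,F_2$ and $p$. Then for $\varepsilon\neq0$ sufficiently small and for every simple zero $(X_0^*,Y_0^* )\neq(0,0)$ of the nonlinear system $\mathcal G_1(X_0,Y_0)=0$, $\mathcal G_2(X_0,Y_0)=0$, the perturbed double pendulum has a periodic solution $(\theta_1(\tau,\varepsilon),\theta_2(\tau,\varepsilon))$ tending when $\varepsilon\to0$ to the periodic solution $(\theta_1(\tau),\theta_2(\tau))$, run $p$ times, of the unperturbed double pendulum ($\varepsilon=0$) given by $$\theta_1(\tau)=\frac{1}{\sqrt{4-2\sqrt2}}\bigl(X_0^*\cos(\omega_1\tau)+Y_0^*\sin(\omega_1\tau)\bigr),\qquad \theta_2(\tau)=\frac{1}{\sqrt{2-\sqrt2}}\bigl(X_0^*\cos(\omega_1\tau)+Y_0^*\sin(\omega_1\tau)\bigr).$$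
   Context: The prime denotes the derivative with respect to $\tau$, and $\varepsilon$ is a real parameter. The unperturbed double pendulum is $\theta_1''=-2\theta_1+\theta_2$, $\theta_2''=2\theta_1-2\theta_2$. With $\omega_1=\sqrt{2-\sqrt2}$ and $T_1=2\pi/\omega_1$, define $$\mathcal G_1(X_0,Y_0)=\int_0^{pT_1}\sin(\omega_1\tau)\bigl(\sqrt2\,\bar F_1+\bar F_2\bigr)\,d\tau,\qquad \mathcal G_2(X_0,Y_0)=\int_0^{pT_1}\cos(\omega_1\tau)\bigl(\sqrt2\,\bar F_1+\bar F_2\bigr)\,d\tau,$$ where $\bar F_k=F_k(\tau,A_1,B_1,C_1,D_1)$ for $k=1,2$ and $$A_1=\frac{1}{\sqrt{4-2\sqrt2}}\bigl(X_0\cos(\omega_1\tau)+Y_0\sin(\omega_1\tau)\bigr),\qquad B_1=\frac{1}{\sqrt2}\bigl(Y_0\cos(\omega_1\tau)-X_0\sin(\omega_1\tau)\bigr),$$ $$C_1=\frac{1}{\sqrt{2-\sqrt2}}\bigl(X_0\cos(\omega_1\tau)+Y_0\sin(\omega_1\tau)\bigr),\qquad D_1=Y_0\cos(\omega_1\tau)-X_0\sin(\omega_1\tau).$$ A zero $(X_0^*,Y_0^* )$ of the system $\mathcal G_1=\mathcal G_2=0$ is called simple if $\det\bigl(\partial(\mathcal G_1,\mathcal G_2)/\partial(X_0,Y_0)\bigr)\neq0$ at $(X_0^*,Y_0^* )$. A $T_1$-periodic solution "run $p$ times" is that solution regarded as a periodic solution of period $pT_1$. "Tending" means $\theta_k(\tau,\varepsilon)\to\theta_k(\tau)$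 as $\varepsilon\to0$ for $k=1,2$ and every $\tau$. *)

theory Defs
  imports "HOL-Analysis.Analysis"
begin

text \<open>\<open>C_k n f\<close>: \<open>f\<close> is n times continuously differentiable on the whole space. Only directional
  derivatives are iterated; for a finite-dimensional domain this is the usual class of functions.\<close>

primrec C_k :: "nat \<Rightarrow> ('a::euclidean_space \<Rightarrow> 'b::real_normed_vector) \<Rightarrow> bool" where
  "C_k 0 f \<longleftrightarrow> continuous_on UNIV f"
| "C_k (Suc n) f \<longleftrightarrow> (\<forall>x. f differentiable (at x)) \<and>
     (\<forall>v. C_k n (\<lambda>x. frechet_derivative f (at x) v))"

definition smooth :: "('a::euclidean_space \<Rightarrow> 'b::real_normed_vector) \<Rightarrow> bool" where
  "smooth f \<longleftrightarrow> (\<forall>n. C_k n f)"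

text \<open>Points of phase space are tuples \<open>(\<theta>\<^sub>1, \<theta>\<^sub>1', \<theta>\<^sub>2, \<theta>\<^sub>2')\<close>, in this order.\<close>

type_synonym phase = "real \<times> real \<times> real \<times> real"

definition \<omega>\<^sub>1 :: real where "\<omega>\<^sub>1 = sqrt (2 - sqrt 2)"

definition T\<^sub>1 :: real where "T\<^sub>1 = 2 * pi / \<omega>\<^sub>1"

definition A\<^sub>1 :: "real \<Rightarrow> real \<Rightarrow> real \<Rightarrow> real" where
  "A\<^sub>1 X Y \<tau> = 1 / sqrt (4 - 2 * sqrt 2) * (X * cos (\<omega>\<^sub>1 * \<tau>) + Y * sin (\<omega>\<^sub>1 * \<tau>))"

definition B\<^sub>1 :: "real \<Rightarrow> real \<Rightarrow> real \<Rightarrow> real" where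
  "B\<^sub>1 X Y \<tau> = 1 / sqrt 2 * (Y * cos (\<omega>\<^sub>1 * \<tau>) - X * sin (\<omega>\<^sub>1 * \<tau>))"

definition C\<^sub>1 :: "real \<Rightarrow> real \<Rightarrow> real \<Rightarrow> real" where
  "C\<^sub>1 X Y \<tau> = 1 / sqrt (2 - sqrt 2) * (X * cos (\<omega>\<^sub>1 * \<tau>) + Y * sin (\<omega>\<^sub>1 * \<tau>))"

definition D\<^sub>1 :: "real \<Rightarrow> real \<Rightarrow> real \<Rightarrow> real" where
  "D\<^sub>1 X Y \<tau> = Y * cos (\<omega>\<^sub>1 * \<tau>) - X * sin (\<omega>\<^sub>1 * \<tau>)"

definition along :: "(real \<times> phase \<Rightarrow> real) \<Rightarrow> real \<Rightarrow> real \<Rightarrow> real \<Rightarrow> real" where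
  "along F X Y \<tau> = F (\<tau>, A\<^sub>1 X Y \<tau>, B\<^sub>1 X Y \<tau>, C\<^sub>1 X Y \<tau>, D\<^sub>1 X Y \<tau>)"

definition \<G>\<^sub>1 :: "(real \<times> phase \<Rightarrow> real) \<Rightarrow> (real \<times> phase \<Rightarrow> real) \<Rightarrow> nat \<Rightarrow> real \<Rightarrow> real \<Rightarrow> real" where
  "\<G>\<^sub>1 F1 F2 p X Y =
     integral {0..real p * T\<^sub>1} (\<lambda>\<tau>. sin (\<omega>\<^sub>1 * \<tau>) * (sqrt 2 * along F1 X Y \<tau> + along F2 X Y \<tau>))"

definition \<G>\<^sub>2 :: "(real \<times> phase \<Rightarrow> real) \<Rightarrow> (real \<times> phase \<Rightarrow> real) \<Rightarrow> nat \<Rightarrow> real \<Rightarrow> real \<Rightarrow> real" where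
  "\<G>\<^sub>2 F1 F2 p X Y =
     integral {0..real p * T\<^sub>1} (\<lambda>\<tau>. cos (\<omega>\<^sub>1 * \<tau>) * (sqrt 2 * along F1 X Y \<tau> + along F2 X Y \<tau>))"

definition simple_zero :: "(real \<Rightarrow> real \<Rightarrow> real) \<Rightarrow> (real \<Rightarrow> real \<Rightarrow> real) \<Rightarrow> real \<Rightarrow> real \<Rightarrow> bool" where
  "simple_zero G1 G2 X Y \<longleftrightarrow> G1 X Y = 0 \<and> G2 X Y = 0 \<and>
     det (jacobian (\<lambda>z :: real^2. vector [G1 (z $ 1) (z $ 2), G2 (z $ 1) (z $ 2)] :: real^2)
            (at (vector [X, Y]))) \<noteq> 0"

text \<open>In the following definition \<open>v1\<close> and \<open>v2\<close> are the derivatives of \<open>\<theta>1\<close> and \<open>\<theta>2\<close>;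
  solutions are defined for all times.\<close>

definition pendulum_solution ::
  "(real \<times> phase \<Rightarrow> real) \<Rightarrow> (real \<times> phase \<Rightarrow> real) \<Rightarrow> real \<Rightarrow> (real \<Rightarrow> real) \<Rightarrow> (real \<Rightarrow> real) \<Rightarrow> bool"
  where
  "pendulum_solution F1 F2 \<epsilon> \<theta>1 \<theta>2 \<longleftrightarrow> (\<exists>v1 v2. \<forall>\<tau>.
     (\<theta>1 has_real_derivative v1 \<tau>) (at \<tau>) \<and>
     (\<theta>2 has_real_derivative v2 \<tau>) (at \<tau>) \<and>
     (v1 has_real_derivative
        (- 2 * \<theta>1 \<tau> + \<theta>2 \<tau> + \<epsilon> * F1 (\<tau>, \<theta>1 \<tau>, v1 \<tau>, \<theta>2 \<tau>, v2 \<tau>))) (at \<tau>) \<and>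
     (v2 has_real_derivative
        (2 * \<theta>1 \<tau> - 2 * \<theta>2 \<tau> + \<epsilon> * F2 (\<tau>, \<theta>1 \<tau>, v1 \<tau>, \<theta>2 \<tau>, v2 \<tau>))) (at \<tau>))"

definition periodic_pendulum_solution ::
  "(real \<times> phase \<Rightarrow> real) \<Rightarrow> (real \<times> phase \<Rightarrow> real) \<Rightarrow> real \<Rightarrow> real \<Rightarrow> (real \<Rightarrow> real) \<Rightarrow> (real \<Rightarrow> real) \<Rightarrow> bool"
  where
  "periodic_pendulum_solution F1 F2 \<epsilon> T \<theta>1 \<theta>2 \<longleftrightarrow> pendulum_solution F1 F2 \<epsilon> \<theta>1 \<theta>2 \<and>
     (\<forall>\<tau>. \<theta>1 (\<tau> + T) = \<theta>1 \<tau> \<and> \<theta>2 (\<tau> + T) = \<theta>2 \<tau>)"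

end

theory Submission
  imports Defs
begin

text \<open>In the complex modes \<open>\<zeta>\<^sub>k = u\<^sub>k' + \<i> \<omega>\<^sub>k u\<^sub>k\<close>, where \<open>u\<^sub>1 = \<surd>2 \<theta>\<^sub>1 + \<theta>\<^sub>2\<close> and \<open>u\<^sub>2 = - \<surd>2 \<theta>\<^sub>1 + \<theta>\<^sub>2\<close>, the
  linear part is diagonal: \<open>\<zeta>\<^sub>k' = \<i> \<omega>\<^sub>k \<zeta>\<^sub>k + \<epsilon> H\<^sub>k\<close>. Over the period \<open>p T\<^sub>1\<close> the first mode is resonant, while the second
  is not, because \<open>\<omega>\<^sub>2 / \<omega>\<^sub>1 = 1 + \<surd>2\<close> is irrational. Hence the second mode is given by a
  convolution with the forcing, and the first one by \<open>cis (\<omega>\<^sub>1 t) z\<close>, for a constant \<open>z\<close>, plus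
  \<open>\<epsilon>\<close> times another convolution, provided that the resonant Fourier coefficient of the forcing
  vanishes (Lyapunov--Schmidt reduction). On unperturbed orbits this coefficient is
  \<open>\<G>\<^sub>2 - \<i> \<G>\<^sub>1\<close>, and at a simple zero a Newton step in \<open>z\<close> makes the whole system a contraction
  on a space of continuous periodic functions. No flow of the differential equation is needed.

  The bound on \<open>\<epsilon>\<close> is uniform in the zeros because only the limit \<open>\<epsilon> \<rightarrow> 0\<close> ties a family of
  solutions to its zero: away from \<open>\<epsilon> = 0\<close> any family may be continued by solutions that belong
  to one fixed simple zero.\<close>


subsection \<open>Uniform estimates for continuously differentiable functions\<close>

text \<open>Level \<open>Suc 0\<close> of \<open>C_k\<close> gives continuity of each directional
  derivative. On a finite-dimensional domain this is continuity in the operator norm, because it can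
  be checked on a basis.\<close>

lemma smooth_imp_C1:
  fixes F :: "'a::euclidean_space \<Rightarrow> 'b::real_normed_vector"
  assumes "smooth F"
  obtains D :: "'a \<Rightarrow> 'a \<Rightarrow>\<^sub>L 'b"
  where "\<And>x. (F has_derivative blinfun_apply (D x)) (at x)" "continuous_on UNIV D"
proof
  let ?D = "\<lambda>x. Blinfun (frechet_derivative F (at x))"
  have C1: "C_k (Suc 0) F" using assms by (simp only: smooth_def)
  then have diff: "(F has_derivative frechet_derivative F (at x)) (at x)" for x
    by (simp add: frechet_derivative_works)
  then have app: "blinfun_apply (?D x) = frechet_derivative F (at x)" for x
    by (intro bounded_linear_Blinfun_apply has_derivative_bounded_linear)
  show "(F has_derivative blinfun_apply (?D x)) (at x)" for x
    using diff by (simp add: app)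
  show "continuous_on UNIV ?D"
    using C1 by (intro continuous_on_blinfun_componentwise) (simp add: app)
qed

text \<open>Strict differentiability in the space variable, uniformly along the curve:
  \<open>D\<close> is uniformly continuous on a compact tube, so \<open>F\<close> minus its
  linearization at \<open>c s\<close> has a derivative of norm at most \<kappa> near
  \<open>c s\<close>, and the mean value inequality applies. The same linear map serves all pairs
  \<open>x\<close>, \<open>y\<close>.\<close>

lemma uniform_strict_derivative:
  fixes F :: "real \<times> 'a::euclidean_space \<Rightarrow> 'b::real_normed_vector"
    and D :: "real \<times> 'a \<Rightarrow> (real \<times> 'a) \<Rightarrow>\<^sub>L 'b"
  assumes deriv: "\<And>p. (F has_derivative blinfun_apply (D p)) (at p)"
    and cont: "continuous_on UNIV D" and c: "continuous_on {0..T} c" and "\<kappa> > 0"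
  obtains r where "r > 0"
    "\<And>s x y. s \<in> {0..T} \<Longrightarrow> x \<in> cball (c s) r \<Longrightarrow> y \<in> cball (c s) r \<Longrightarrow>
       norm (F (s, x) - F (s, y) - D (s, c s) (0, x - y)) \<le> \<kappa> * norm (x - y)"
proof -
  have "compact (c ` {0..T})" by (intro compact_continuous_image c compact_Icc)
  then obtain R where R: "\<And>s. s \<in> {0..T} \<Longrightarrow> norm (c s) \<le> R"
    by (meson bounded_iff compact_imp_bounded image_eqI)
  let ?K = "{0..T} \<times> cball (0::'a) (R + 1)"
  have "uniformly_continuous_on ?K D"
    by (intro compact_uniformly_continuous compact_Times compact_Icc compact_cball
        continuous_on_subset[OF cont]) auto
  then obtain d where d: "d > 0"
    "\<And>p q. p \<in> ?K \<Longrightarrow> q \<in> ?K \<Longrightarrow> dist p q < d \<Longrightarrow> dist (D p) (D q) < \<kappa>"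
    unfolding uniformly_continuous_on_def using \<open>\<kappa> > 0\<close> by metis
  \<comment> \<open>The bound 1 keeps the ball inside \<open>?K\<close>, whose radius
    \<open>R + 1\<close> leaves this room; halving \<open>d\<close> makes distances in the closed
    ball strictly smaller than \<open>d\<close>.\<close>
  define r where "r = min 1 (d / 2)"
  show ?thesis
  proof
    show "r > 0" using d by (simp add: r_def)
    fix s x y assume s: "s \<in> {0..T}" and x: "x \<in> cball (c s) r" and y: "y \<in> cball (c s) r"
    let ?G = "\<lambda>x. F (s, x) - D (s, c s) (0, x)"
    let ?G' = "\<lambda>x v. D (s, x) (0, v) - D (s, c s) (0, v)"
    have "norm (?G x - ?G y) \<le> \<kappa> * norm (x - y)"
    proof (rule differentiable_bound[OF convex_cball _ _ x y])
      fix u assume u: "u \<in> cball (c s) r"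
      have "((\<lambda>u. F (s, u)) has_derivative (\<lambda>v. D (s, u) (0, v))) (at u within cball (c s) r)"
        by (rule has_derivative_compose[OF _ deriv, of "\<lambda>u. (s, u)"])
          (auto intro!: derivative_eq_intros)
      moreover have "((\<lambda>u. D (s, c s) (0, u)) has_derivative (\<lambda>v. D (s, c s) (0, v)))
          (at u within cball (c s) r)"
        by (auto intro!: derivative_eq_intros)
      ultimately show "(?G has_derivative ?G' u) (at u within cball (c s) r)"
        by (rule has_derivative_diff)
      have "norm u \<le> norm (c s) + dist (c s) u"
        by (metis dist_norm norm_minus_commute norm_triangle_sub)
      then have "norm u \<le> R + 1" using R[OF s] u by (simp add: r_def)
      moreover have "dist (s, u) (s, c s) < d"
        using u d(1) by (simp add: dist_Pair_Pair dist_commute r_def)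
      ultimately have "dist (D (s, u)) (D (s, c s)) < \<kappa>"
        using R[OF s] s by (intro d(2)) auto
      then have "norm (D (s, u) - D (s, c s)) \<le> \<kappa>" by (simp add: dist_norm)
      then have "norm (?G' u v) \<le> \<kappa> * norm v" for v
      proof -
        have "norm (?G' u v) = norm ((D (s, u) - D (s, c s)) (0, v))"
          by (simp add: minus_blinfun.rep_eq)
        also have "\<dots> \<le> norm (D (s, u) - D (s, c s)) * norm (0::real, v)" by (rule norm_blinfun)
        also have "\<dots> \<le> \<kappa> * norm v"
          using \<open>norm (D (s, u) - D (s, c s)) \<le> \<kappa>\<close>
          by (simp add: norm_Pair mult_right_mono)
        finally show ?thesis .
      qed
      then show "onorm (?G' u) \<le> \<kappa>" by (rule onorm_le)
    qed
    moreover have "?G x - ?G y = F (s, x) - F (s, y) - D (s, c s) (0, x - y)"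
    proof -
      have "D (s, c s) (0, x - y) = D (s, c s) (0, x) - D (s, c s) (0, y)"
        by (subst blinfun.diff_right[symmetric]) simp
      then show ?thesis by simp
    qed
    ultimately show "norm (F (s, x) - F (s, y) - D (s, c s) (0, x - y)) \<le> \<kappa> * norm (x - y)"
      by simp
  qed
qed

section \<open>Periodic functions and compactness on one period\<close>

lemma periodic_int_shift:
  fixes f :: "real \<Rightarrow> 'a"
  assumes "\<And>t. f (t + T) = f t"
  shows "f (t + of_int n * T) = f t"
proof -
  have nat: "f (t + real n * T) = f t" for n t
    by (induction n) (auto simp: algebra_simps assms, metis add.assoc add.commute assms)
  show ?thesis
  proof (cases "n \<ge> 0")
    case True
    then show ?thesis using nat[of t "nat n"] by simp
  next
    case False
    then show ?thesis using nat[of "t + of_int n * T" "nat (- n)"] by simp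
  qed
qed

lemma periodic_reduce:
  fixes T t :: real
  assumes "T > 0"
  obtains n :: int where "t + of_int n * T \<in> {0..T}"
proof
  have "of_int \<lfloor>t / T\<rfloor> * T \<le> t" "t < (of_int \<lfloor>t / T\<rfloor> + 1) * T"
    using assms by (simp_all flip: pos_le_divide_eq pos_divide_less_eq)
  then show "t + of_int (- \<lfloor>t / T\<rfloor>) * T \<in> {0..T}"
    by (simp add: algebra_simps)
qed

text \<open>Compactness yields bounds on one period only; for a periodic predicate they carry over
  to all times.\<close>

lemma periodic_all:
  fixes P :: "real \<Rightarrow> bool"
  assumes "T > 0" "\<And>t. P (t + T) = P t" "\<And>t. t \<in> {0..T} \<Longrightarrow> P t"
  shows "P t"
  using periodic_reduce[OF assms(1), of t] periodic_int_shift[of P T t] assms(2,3) by metis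

lemma uniform_derivative_bound:
  fixes D :: "real \<times> 'a::euclidean_space \<Rightarrow> (real \<times> 'a) \<Rightarrow>\<^sub>L 'b::real_normed_vector"
  assumes "continuous_on UNIV D" "continuous_on {0..T} c"
  obtains B where "B \<ge> 0" "\<And>s v. s \<in> {0..T} \<Longrightarrow> norm (D (s, c s) (0, v)) \<le> B * norm v"
proof -
  have "compact ((\<lambda>s. D (s, c s)) ` {0..T})"
    by (intro compact_continuous_image compact_Icc continuous_on_compose2[OF assms(1)]
        continuous_intros assms(2)) auto
  then obtain B where "B > 0" "\<forall>x\<in>(\<lambda>s. D (s, c s)) ` {0..T}. norm x \<le> B"
    using bounded_pos compact_imp_bounded by blast
  then have B: "norm (D (s, c s)) \<le> B" "B \<ge> 0" if "s \<in> {0..T}" for s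
    using that by auto
  show ?thesis
  proof
    fix s v assume "s \<in> {0..T}"
    then show "norm (D (s, c s) (0, v)) \<le> B * norm v"
      using order_trans[OF norm_blinfun mult_right_mono[OF B(1) norm_ge_zero], of s "(0, v)"]
      by (simp add: norm_Pair)
  qed (use \<open>B > 0\<close> in simp)
qed

text \<open>The strict derivative estimate with constant 1 and the bound \<open>B\<close> of the
  derivative along the curve give the Lipschitz constant \<open>1 + B\<close> on one period. The
  bound is wanted at all times because a convolution evaluates the forcing at
  \<open>t + s\<close>.\<close>

lemma uniform_lipschitz_near_curve:
  fixes F :: "real \<times> 'a::euclidean_space \<Rightarrow> 'b::real_normed_vector"
    and D :: "real \<times> 'a \<Rightarrow> (real \<times> 'a) \<Rightarrow>\<^sub>L 'b"
  assumes deriv: "\<And>p. (F has_derivative blinfun_apply (D p)) (at p)"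
    and cont: "continuous_on UNIV D" and c: "continuous_on {0..T} c"
    and T: "T > 0" and per: "\<And>t x. F (t + T, x) = F (t, x)" "\<And>t. c (t + T) = c t"
  obtains r L where "r > 0" "L \<ge> 0"
    "\<And>s x y. x \<in> cball (c s) r \<Longrightarrow> y \<in> cball (c s) r \<Longrightarrow>
       norm (F (s, x) - F (s, y)) \<le> L * norm (x - y)"
proof -
  obtain B where B: "B \<ge> 0" "\<And>s v. s \<in> {0..T} \<Longrightarrow> norm (D (s, c s) (0, v)) \<le> B * norm v"
    using uniform_derivative_bound[OF cont c] by blast
  obtain r where r: "r > 0"
    "\<And>s x y. s \<in> {0..T} \<Longrightarrow> x \<in> cball (c s) r \<Longrightarrow> y \<in> cball (c s) r \<Longrightarrow>
       norm (F (s, x) - F (s, y) - D (s, c s) (0, x - y)) \<le> 1 * norm (x - y)"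
    using uniform_strict_derivative[OF deriv cont c zero_less_one] by blast
  show ?thesis
  proof
    show "r > 0" "1 + B \<ge> 0" using r B by auto
    fix s x y
    have "\<forall>x\<in>cball (c s) r. \<forall>y\<in>cball (c s) r. norm (F (s, x) - F (s, y)) \<le> (1 + B) * norm (x - y)"
    proof (rule periodic_all[OF T, of _ s])
      fix s assume s: "s \<in> {0..T}"
      show "\<forall>x\<in>cball (c s) r. \<forall>y\<in>cball (c s) r. norm (F (s, x) - F (s, y)) \<le> (1 + B) * norm (x - y)"
      proof (intro ballI)
        fix x y assume "x \<in> cball (c s) r" "y \<in> cball (c s) r"
        then show "norm (F (s, x) - F (s, y)) \<le> (1 + B) * norm (x - y)"
          using r(2)[OF s, of x y] B(2)[OF s, of "x - y"]
            norm_triangle_sub[of "F (s, x) - F (s, y)" "D (s, c s) (0, x - y)"]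
          by (simp add: algebra_simps)
      qed
    qed (simp add: per)
    then show "norm (F (s, x) - F (s, y)) \<le> (1 + B) * norm (x - y)"
      if "x \<in> cball (c s) r" "y \<in> cball (c s) r" using that by blast
  qed
qed

text \<open>The ball of radius \<open>2 * \<rho>\<close> is mapped to itself: its points are sent
  within \<rho> of \<open>f x0\<close>, which is within \<rho> of the centre. The closed set
  \<open>S\<close> will express periodicity.\<close>

lemma Banach_fix_ball:
  fixes f :: "'a::complete_space \<Rightarrow> 'a"
  assumes "closed S" "x0 \<in> S" "dist (f x0) x0 \<le> \<rho>"
    and "\<And>x. x \<in> S \<Longrightarrow> dist x x0 \<le> 2 * \<rho> \<Longrightarrow> f x \<in> S"
    and lip: "\<And>x y. x \<in> S \<Longrightarrow> y \<in> S \<Longrightarrow> dist x x0 \<le> 2 * \<rho> \<Longrightarrow> dist y x0 \<le> 2 * \<rho> \<Longrightarrow>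
       dist (f x) (f y) \<le> 1/2 * dist x y"
  obtains x where "x \<in> S" "dist x x0 \<le> 2 * \<rho>" "f x = x"
proof -
  let ?S = "S \<inter> cball x0 (2 * \<rho>)"
  have \<rho>: "\<rho> \<ge> 0" using assms(3) zero_le_dist order_trans by blast
  have "\<exists>!x\<in>?S. f x = x"
  proof (rule Banach_fix[where c = "1/2"])
    show "complete ?S" using assms(1) by (simp add: complete_eq_closed closed_Int)
    show "?S \<noteq> {}" using assms(2) \<rho> by auto
    show "f ` ?S \<subseteq> ?S"
    proof (rule image_subsetI)
      fix x assume x: "x \<in> ?S"
      have "dist (f x) x0 \<le> dist (f x) (f x0) + dist (f x0) x0" by (rule dist_triangle)
      also have "\<dots> \<le> 1/2 * dist x x0 + \<rho>"
        using lip[of x x0] assms(2,3) x \<rho> by (auto simp: dist_commute)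
      also have "\<dots> \<le> 2 * \<rho>" using x by (simp add: dist_commute)
      finally show "f x \<in> ?S" using assms(4) x by (auto simp: dist_commute)
    qed
  qed (use lip in \<open>auto simp: dist_commute\<close>)
  then show ?thesis using that by (auto simp: dist_commute)
qed

subsection \<open>Convolution over a window\<close>

lemma antiderivative_real_line:
  fixes f :: "real \<Rightarrow> 'a::euclidean_space"
  assumes "continuous_on UNIV f"
  obtains A where "\<And>t. (A has_vector_derivative f t) (at t)"
  using einterval_antiderivative[of "-\<infinity>" "\<infinity>" f] assms
  by (auto simp: continuous_on_eq_continuous_at)

text \<open>The interval is fixed and \<open>h\<close> is shifted, so that for a
  \<open>T\<close>-periodic \<open>h\<close> the result is \<open>T\<close>-periodic whatever the
  kernel is.\<close>

definition window_conv :: "real \<Rightarrow> (real \<Rightarrow> complex) \<Rightarrow> (real \<Rightarrow> complex) \<Rightarrow> real \<Rightarrow> complex" where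
  "window_conv T k h t = integral {0..T} (\<lambda>s. k s * h (t + s))"

lemma window_conv_integrable:
  fixes k h :: "real \<Rightarrow> complex"
  assumes "continuous_on UNIV k" "continuous_on UNIV h"
  shows "(\<lambda>s. k s * h (t + s)) integrable_on {0..T}"
  by (intro integrable_continuous_real continuous_on_mult continuous_on_subset[OF assms(1)]
      continuous_on_compose2[OF assms(2)] continuous_intros) auto

lemma window_conv_continuous:
  assumes "continuous_on UNIV k" "continuous_on UNIV h"
  shows "continuous_on UNIV (window_conv T k h)"
proof -
  have "continuous_on UNIV (\<lambda>t. integral (cbox 0 T) (\<lambda>s. k s * h (t + s)))"
    by (rule integral_continuous_on_param)
      (auto simp: split_beta intro!: continuous_intros continuous_on_compose2[OF assms(1)]
        continuous_on_compose2[OF assms(2)])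
  then show ?thesis by (simp add: window_conv_def[abs_def])
qed

lemma window_conv_diff:
  assumes "continuous_on UNIV k" "continuous_on UNIV h" "continuous_on UNIV g"
  shows "window_conv T k h t - window_conv T k g t = window_conv T k (\<lambda>s. h s - g s) t"
  unfolding window_conv_def
  by (subst integral_diff[symmetric]) (auto intro!: window_conv_integrable assms simp: right_diff_distrib)

lemma norm_window_conv_le:
  assumes "continuous_on UNIV k" "continuous_on UNIV h" "T \<ge> 0"
    and "\<And>s. s \<in> {0..T} \<Longrightarrow> norm (k s) \<le> K" "\<And>s. norm (h s) \<le> B"
  shows "norm (window_conv T k h t) \<le> T * K * B"
proof -
  have "K \<ge> 0" using order_trans[OF norm_ge_zero assms(4)[of 0]] assms(3) by simp
  have "norm (integral {0..T} (\<lambda>s. k s * h (t + s))) \<le> K * B * (T - 0)"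
    using assms \<open>K \<ge> 0\<close>
    by (intro integral_bound)
      (auto simp: norm_mult intro!: mult_mono continuous_intros continuous_on_subset[OF assms(1)]
      continuous_on_compose2[OF assms(2)])
  then show ?thesis by (simp add: window_conv_def mult_ac)
qed

text \<open>After an integration by parts against an antiderivative of \<open>h\<close>, which need not be
  differentiable itself, one may differentiate under the integral.\<close>

lemma window_conv_has_vector_derivative:
  assumes T: "T \<ge> 0" and k: "\<And>s. (k has_vector_derivative k' s) (at s)"
    and k': "continuous_on UNIV k'" and h: "continuous_on UNIV h"
  shows "(window_conv T k h has_vector_derivative
    (k T * h (t + T) - k 0 * h t - window_conv T k' h t)) (at t)"
proof -
  obtain A where A: "\<And>t. (A has_vector_derivative h t) (at t)"
    using antiderivative_real_line[OF h] by blast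
  have contk: "continuous_on UNIV k"
    using k has_vector_derivative_continuous continuous_on_eq_continuous_within by blast
  have contA: "continuous_on UNIV A"
    using A has_vector_derivative_continuous continuous_on_eq_continuous_within by blast
  have A_shift: "((\<lambda>s. A (s + c)) has_vector_derivative h (t + c)) (at t)" for t c
    using vector_diff_chain_at[of "\<lambda>s. s + c" 1 t A "h (t + c)"] A
    by (simp add: o_def has_vector_derivative_add[of "\<lambda>s. s" 1 _ "\<lambda>_. c" 0, simplified])
  have A_shift': "((\<lambda>s. A (c + s)) has_vector_derivative h (c + t)) (at t)" for t c
    using A_shift[of c t] by (simp add: add.commute)
  have parts: "window_conv T k h t = k T * A (t + T) - k 0 * A t - window_conv T k' A t" for t
  proof -
    have "((\<lambda>s. h (t + s) * k s) has_integral
        k T * A (t + T) - k 0 * A t - window_conv T k' A t) {0..T}"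
    proof (rule integration_by_parts[OF bounded_bilinear_mult T,
          where f = "\<lambda>s. A (t + s)" and g = k and g' = k'])
      show "((\<lambda>s. A (t + s) * k' s) has_integral A (t + T) * k T - A (t + 0) * k 0 -
          (k T * A (t + T) - k 0 * A t - window_conv T k' A t)) {0..T}"
        using window_conv_integrable[OF k' contA, THEN integrable_integral]
        by (simp add: window_conv_def mult.commute)
    qed (auto intro!: A_shift' k continuous_on_subset[OF contk] continuous_on_compose2[OF contA]
        continuous_intros)
    then have "((\<lambda>s. k s * h (t + s)) has_integral
        k T * A (t + T) - k 0 * A t - window_conv T k' A t) {0..T}"
      by (simp add: mult.commute)
    then show ?thesis by (simp add: window_conv_def integral_unique)
  qed
  have "((\<lambda>t. integral (cbox 0 T) (\<lambda>s. k' s * A (t + s))) has_vector_derivative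
      integral (cbox 0 T) (\<lambda>s. k' s * h (t + s))) (at t)"
    by (rule leibniz_rule_vector_derivative[where U = UNIV, simplified])
     (auto simp: split_beta simp del: interval_cbox intro!: has_vector_derivative_mult_right A_shift
         continuous_intros continuous_on_compose2[OF k'] continuous_on_compose2[OF h]
         window_conv_integrable[OF k' contA, folded interval_cbox])
  then have "(window_conv T k' A has_vector_derivative window_conv T k' h t) (at t)"
    by (simp add: window_conv_def[abs_def])
  then show ?thesis
    unfolding parts[abs_def]
    by (intro has_vector_derivative_diff has_vector_derivative_mult_right A_shift A)
qed

lemma cis_has_vector_derivative:
  "((\<lambda>s. cis (c * s)) has_vector_derivative \<i> * c * cis (c * s)) (at s)"
proof -
  have "((\<lambda>s. cis (c * s)) has_vector_derivative c *\<^sub>R (\<i> * cis (c * s))) (at s)"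
    using vector_diff_chain_at[of "\<lambda>s. c * s" c s cis "\<i> * cis (c * s)"]
      has_derivative_cis[of "\<lambda>x. x"]
    by (auto simp: o_def has_vector_derivative_def intro!: derivative_eq_intros)
  then show ?thesis by (simp add: scaleR_conv_of_real mult_ac)
qed

subsection \<open>A resonant and a nonresonant mode\<close>

locale resonant_modes =
  fixes T a b :: real and H1 H2 :: "real \<times> complex \<times> complex \<Rightarrow> complex"
    and D1 D2 :: "real \<times> complex \<times> complex \<Rightarrow> (real \<times> complex \<times> complex) \<Rightarrow>\<^sub>L complex"
  assumes T_pos: "T > 0" and res: "cis (a * T) = 1" and nonres: "cis (b * T) \<noteq> 1"
    and deriv: "\<And>p. (H1 has_derivative blinfun_apply (D1 p)) (at p)"
      "\<And>p. (H2 has_derivative blinfun_apply (D2 p)) (at p)"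
    and cont_deriv: "continuous_on UNIV D1" "continuous_on UNIV D2"
    and per: "\<And>t x. H1 (t + T, x) = H1 (t, x)" "\<And>t x. H2 (t + T, x) = H2 (t, x)"
begin

text \<open>The unperturbed periodic motions. The second component is zero because a nonzero free
  oscillation of the nonresonant mode is not \<open>T\<close>-periodic.\<close>

definition orbit :: "complex \<Rightarrow> real \<Rightarrow> complex \<times> complex" where
  "orbit z s = (cis (a * s) * z, 0)"

text \<open>Up to the factor \<open>1 / T\<close>, the Fourier coefficient of the forcing at the
  frequency \<open>a\<close>; its vanishing is the solvability condition for the first mode.\<close>

definition resonance :: "(real \<Rightarrow> complex \<times> complex) \<Rightarrow> complex" where
  "resonance x = integral {0..T} (\<lambda>s. cis (- (a * s)) * H1 (s, x s))"

text \<open>The result of differentiating \<open>resonance (orbit z)\<close> under the integral in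
  the direction \<open>v\<close>; as \<open>orbit\<close> is linear in its parameter, the orbit
  changes by \<open>orbit v\<close>.\<close>

definition resonance_deriv :: "complex \<Rightarrow> complex \<Rightarrow> complex" where
  "resonance_deriv z v = integral {0..T} (\<lambda>s. cis (- (a * s)) * D1 (s, orbit z s) (0, orbit v s))"

lemma cis_reduce: "cis (c * (s + T)) = cis (c * s) * cis (c * T)"
  by (simp add: cis_mult algebra_simps)

lemma orbit_per [simp]: "orbit z (s + T) = orbit z s"
  using res by (simp add: orbit_def cis_reduce)

lemma norm_orbit [simp]: "norm (orbit z s) = norm z"
  by (simp add: orbit_def norm_Pair norm_mult)

lemma orbit_diff: "orbit z s - orbit v s = orbit (z - v) s"
  by (simp add: orbit_def algebra_simps)

lemma continuous_on_orbit [continuous_intros]: "continuous_on S (orbit z)"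
  unfolding orbit_def[abs_def] by (intro continuous_intros)

lemma continuous_on_H:
  assumes "continuous_on UNIV x"
  shows "continuous_on UNIV (\<lambda>s. H1 (s, x s))" "continuous_on UNIV (\<lambda>s. H2 (s, x s))"
proof -
  have "continuous_on UNIV H1" "continuous_on UNIV H2"
    by (auto intro!: continuous_at_imp_continuous_on has_derivative_continuous[OF deriv(1)]
        has_derivative_continuous[OF deriv(2)])
  moreover have "continuous_on UNIV (\<lambda>s. (s, x s))"
    by (intro continuous_intros assms)
  ultimately show "continuous_on UNIV (\<lambda>s. H1 (s, x s))" "continuous_on UNIV (\<lambda>s. H2 (s, x s))"
    using continuous_on_compose2[where f = "\<lambda>s. (s, x s)" and s = UNIV and t = UNIV] by auto
qed

lemma continuous_on_linearization:
  "continuous_on S (\<lambda>s. cis (- (a * s)) * D1 (s, orbit z s) (0, orbit v s))"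
  by (intro continuous_intros continuous_on_compose2[OF cont_deriv(1)]) auto

lemma continuous_on_resonance_integrand:
  assumes "continuous_on UNIV x"
  shows "continuous_on S (\<lambda>s. cis (- (a * s)) * H1 (s, x s))"
  by (rule continuous_on_subset[of UNIV]) (auto intro!: continuous_intros continuous_on_H assms)

section \<open>Strict differentiability of the resonance coefficient\<close>

lemma linear_resonance_deriv: "linear (resonance_deriv z)"
proof
  fix v w :: complex and c :: real
  have add: "orbit (v + w) s = orbit v s + orbit w s" for s by (simp add: orbit_def algebra_simps)
  have "(0, orbit (v + w) s) = (0::real, orbit v s) + (0, orbit w s)" for s by (simp add: add)
  then show "resonance_deriv z (v + w) = resonance_deriv z v + resonance_deriv z w"
    unfolding resonance_deriv_def
    by (simp only: blinfun.add_right distrib_left)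
      (intro integral_add integrable_continuous_real continuous_on_linearization)
  have "(0, orbit (c *\<^sub>R v) s) = c *\<^sub>R (0::real, orbit v s)" for s by (simp add: orbit_def)
  then show "resonance_deriv z (c *\<^sub>R v) = c *\<^sub>R resonance_deriv z v"
    unfolding resonance_deriv_def
    by (simp only: blinfun.scaleR_right mult_scaleR_right integral_cmul)
qed

text \<open>The contraction argument compares orbits plus small corrections, so the increment may
  differ from \<open>orbit v\<close> by \<delta>. Strict differentiability costs \<kappa> times the
  increment, and the derivative, bounded by \<open>B\<close>, costs \<open>B * \<delta>\<close> on
  the deviation; integration gives the factor \<open>T\<close>.\<close>

lemma resonance_strict:
  obtains B where "B \<ge> 0"
    "\<And>\<kappa>. \<kappa> > 0 \<Longrightarrow> \<exists>r>0. \<forall>x y v \<delta>. continuous_on UNIV x \<longrightarrow> continuous_on UNIV y \<longrightarrow>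
       (\<forall>s\<in>{0..T}. x s \<in> cball (orbit z s) r \<and> y s \<in> cball (orbit z s) r \<and>
          norm (x s - y s - orbit v s) \<le> \<delta>) \<longrightarrow>
       norm (resonance x - resonance y - resonance_deriv z v) \<le> T * (\<kappa> * (norm v + \<delta>) + B * \<delta>)"
proof -
  have c: "continuous_on {0..T} (orbit z)" by (rule continuous_on_orbit)
  obtain B where B: "B \<ge> 0" "\<And>s v. s \<in> {0..T} \<Longrightarrow> norm (D1 (s, orbit z s) (0, v)) \<le> B * norm v"
    using uniform_derivative_bound[OF cont_deriv(1) c] by blast
  show ?thesis
  proof (rule that[OF B(1)])
    fix \<kappa> :: real assume \<kappa>: "\<kappa> > 0"
    obtain r where r: "r > 0"
      "\<And>s x y. s \<in> {0..T} \<Longrightarrow> x \<in> cball (orbit z s) r \<Longrightarrow> y \<in> cball (orbit z s) r \<Longrightarrow>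
         norm (H1 (s, x) - H1 (s, y) - D1 (s, orbit z s) (0, x - y)) \<le> \<kappa> * norm (x - y)"
      using uniform_strict_derivative[OF deriv(1) cont_deriv(1) c \<kappa>] by blast
    show "\<exists>r>0. \<forall>x y v \<delta>. continuous_on UNIV x \<longrightarrow> continuous_on UNIV y \<longrightarrow>
       (\<forall>s\<in>{0..T}. x s \<in> cball (orbit z s) r \<and> y s \<in> cball (orbit z s) r \<and>
          norm (x s - y s - orbit v s) \<le> \<delta>) \<longrightarrow>
       norm (resonance x - resonance y - resonance_deriv z v) \<le> T * (\<kappa> * (norm v + \<delta>) + B * \<delta>)"
    proof (intro exI conjI allI impI)
      fix x y v \<delta>
      assume x: "continuous_on UNIV x" and y: "continuous_on UNIV y"
        and xy: "\<forall>s\<in>{0..T}. x s \<in> cball (orbit z s) r \<and> y s \<in> cball (orbit z s) r \<and>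
          norm (x s - y s - orbit v s) \<le> \<delta>"
      let ?g = "\<lambda>s. cis (- (a * s)) * H1 (s, x s) - cis (- (a * s)) * H1 (s, y s)
        - cis (- (a * s)) * D1 (s, orbit z s) (0, orbit v s)"
      have bound: "norm (?g s) \<le> \<kappa> * (norm v + \<delta>) + B * \<delta>" if s: "s \<in> {0..T}" for s
      proof -
        let ?D = "D1 (s, orbit z s)"
        have split: "?D (0, x s - y s) - ?D (0, orbit v s) = ?D (0, x s - y s - orbit v s)"
          by (subst blinfun.diff_right[symmetric]) simp
        have "?g s = cis (- (a * s)) * ((H1 (s, x s) - H1 (s, y s) - ?D (0, x s - y s))
            + ?D (0, x s - y s - orbit v s))"
          unfolding split[symmetric] by (simp add: algebra_simps)
        then have "norm (?g s) = norm ((H1 (s, x s) - H1 (s, y s) - ?D (0, x s - y s))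
            + ?D (0, x s - y s - orbit v s))" by (simp only: norm_mult norm_cis mult_1)
        also have "\<dots> \<le> \<kappa> * norm (x s - y s) + B * norm (x s - y s - orbit v s)"
          using s xy by (intro norm_triangle_mono r(2) B(2)) auto
        also have "\<dots> \<le> \<kappa> * (norm v + \<delta>) + B * \<delta>"
        proof (intro add_mono mult_left_mono)
          show "norm (x s - y s) \<le> norm v + \<delta>"
            using norm_triangle_sub[of "x s - y s" "orbit v s"] bspec[OF xy s] by simp
        qed (use \<kappa> B(1) bspec[OF xy s] in simp_all)
        finally show ?thesis .
      qed
      have "norm (integral {0..T} ?g) \<le> (\<kappa> * (norm v + \<delta>) + B * \<delta>) * (T - 0)"
        using T_pos bound
        by (intro integral_bound continuous_on_diff continuous_on_resonance_integrand
            continuous_on_linearization x y) auto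
      moreover have "integral {0..T} ?g = resonance x - resonance y - resonance_deriv z v"
        unfolding resonance_def resonance_deriv_def
        by (simp add: integral_diff integrable_diff integrable_continuous_real x y
            continuous_on_resonance_integrand continuous_on_linearization)
      ultimately show "norm (resonance x - resonance y - resonance_deriv z v)
          \<le> T * (\<kappa> * (norm v + \<delta>) + B * \<delta>)" by (simp add: mult.commute)
    qed (rule r)
  qed
qed

text \<open>The case of the strict estimate in which both functions are orbits, so that \<delta> is
  0; the choice \<open>e / T\<close> absorbs the length of the interval.\<close>

lemma resonance_has_derivative:
  "((\<lambda>z. resonance (orbit z)) has_derivative resonance_deriv z) (at z)"
  unfolding has_derivative_at_alt
proof (intro conjI allI impI)
  show "bounded_linear (resonance_deriv z)"
    using linear_resonance_deriv by (simp add: linear_conv_bounded_linear)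
  fix e :: real assume "e > 0"
  obtain B where B: "\<And>\<kappa>. \<kappa> > 0 \<Longrightarrow> \<exists>r>0. \<forall>x y v \<delta>. continuous_on UNIV x \<longrightarrow> continuous_on UNIV y \<longrightarrow>
       (\<forall>s\<in>{0..T}. x s \<in> cball (orbit z s) r \<and> y s \<in> cball (orbit z s) r \<and>
          norm (x s - y s - orbit v s) \<le> \<delta>) \<longrightarrow>
       norm (resonance x - resonance y - resonance_deriv z v) \<le> T * (\<kappa> * (norm v + \<delta>) + B * \<delta>)"
    using resonance_strict[of z] by metis
  have "e / T > 0" using \<open>e > 0\<close> T_pos by simp
  then obtain r where "r > 0" and r: "\<And>x y v \<delta>. continuous_on UNIV x \<Longrightarrow> continuous_on UNIV y \<Longrightarrow>
       (\<forall>s\<in>{0..T}. x s \<in> cball (orbit z s) r \<and> y s \<in> cball (orbit z s) r \<and>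
          norm (x s - y s - orbit v s) \<le> \<delta>) \<Longrightarrow>
       norm (resonance x - resonance y - resonance_deriv z v) \<le> T * (e / T * (norm v + \<delta>) + B * \<delta>)"
    using B[of "e / T"] by blast
  show "\<exists>d>0. \<forall>y. norm (y - z) < d \<longrightarrow>
      norm (resonance (orbit y) - resonance (orbit z) - resonance_deriv z (y - z)) \<le> e * norm (y - z)"
  proof (intro exI conjI allI impI)
    fix y assume "norm (y - z) < r"
    then show "norm (resonance (orbit y) - resonance (orbit z) - resonance_deriv z (y - z)) \<le> e * norm (y - z)"
      using r[of "orbit y" "orbit z" "y - z" 0] T_pos \<open>r > 0\<close>
      by (simp add: continuous_on_orbit dist_norm orbit_diff norm_minus_commute)
  qed (rule \<open>r > 0\<close>)
qed

text \<open>Convolving a \<open>T\<close>-periodic forcing with these kernels yields \<open>T\<close>-periodic solutions of the forced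
  linear mode equations; in the resonant case this only holds if \<open>resonance\<close> vanishes, but the
  convolution is periodic in any case, so that the fixed point map can be defined without this
  condition.\<close>

definition resonant_kernel :: "real \<Rightarrow> complex" where
  "resonant_kernel s = complex_of_real (s / T) * cis (- (a * s))"

definition nonresonant_kernel :: "real \<Rightarrow> complex" where
  "nonresonant_kernel s = cis (- (b * s)) / (cis (- (b * T)) - 1)"

definition response :: "(real \<Rightarrow> complex \<times> complex) \<Rightarrow> real \<Rightarrow> complex \<times> complex" where
  "response x t = (window_conv T resonant_kernel (\<lambda>s. H1 (s, x s)) t,
    window_conv T nonresonant_kernel (\<lambda>s. H2 (s, x s)) t)"

definition kernel_bound :: real where
  "kernel_bound = max 1 (1 / norm (cis (- (b * T)) - 1))"

lemma kernel_bound_pos: "kernel_bound > 0"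
  by (simp add: kernel_bound_def)

lemma continuous_on_kernels:
  "continuous_on S resonant_kernel" "continuous_on S nonresonant_kernel"
  unfolding resonant_kernel_def[abs_def] nonresonant_kernel_def[abs_def] divide_inverse
  by (intro continuous_intros)+

lemma norm_kernels_le:
  assumes "s \<in> {0..T}"
  shows "norm (resonant_kernel s) \<le> kernel_bound" "norm (nonresonant_kernel s) \<le> kernel_bound"
proof -
  have "norm (resonant_kernel s) \<le> 1"
    using assms T_pos by (simp add: resonant_kernel_def norm_mult norm_divide divide_le_eq)
  then show "norm (resonant_kernel s) \<le> kernel_bound" by (simp add: kernel_bound_def)
  show "norm (nonresonant_kernel s) \<le> kernel_bound"
    by (simp add: nonresonant_kernel_def kernel_bound_def norm_divide)
qed

section \<open>Continuity, periodicity and size of the response\<close>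

lemma response_continuous: "continuous_on UNIV x \<Longrightarrow> continuous_on S (response x)"
  unfolding response_def[abs_def]
  by (rule continuous_on_subset[of UNIV])
    (auto intro!: continuous_on_Pair window_conv_continuous continuous_on_kernels continuous_on_H)

lemma response_periodic:
  assumes "\<And>t. x (t + T) = x t"
  shows "response x (t + T) = response x t"
proof -
  have "x (t + T + s) = x (t + s)" for s using assms[of "t + s"] by (simp add: add_ac)
  moreover have "H1 (t + T + s, y) = H1 (t + s, y)" "H2 (t + T + s, y) = H2 (t + s, y)" for s y
    using per[of "t + s" y] by (simp_all add: add_ac)
  ultimately show ?thesis by (simp add: response_def window_conv_def)
qed

lemma norm_pair_le:
  fixes u v :: complex
  assumes "norm u \<le> e" "norm v \<le> e" shows "norm (u, v) \<le> 2 * e"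
  using norm_Pair_le[of u v] assms by linarith

lemma norm_response_le:
  assumes x: "continuous_on UNIV x"
    and "\<And>s. norm (H1 (s, x s)) \<le> \<delta>" "\<And>s. norm (H2 (s, x s)) \<le> \<delta>"
  shows "norm (response x t) \<le> 2 * (T * kernel_bound * \<delta>)"
  unfolding response_def using T_pos
  by (intro norm_pair_le norm_window_conv_le continuous_on_kernels continuous_on_H x assms
      norm_kernels_le) auto

lemma norm_response_diff_le:
  assumes x: "continuous_on UNIV x" and y: "continuous_on UNIV y"
    and "\<And>s. norm (H1 (s, x s) - H1 (s, y s)) \<le> \<delta>" "\<And>s. norm (H2 (s, x s) - H2 (s, y s)) \<le> \<delta>"
  shows "norm (response x t - response y t) \<le> 2 * (T * kernel_bound * \<delta>)"
  unfolding response_def diff_Pair using T_pos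
  by (subst (1 2) window_conv_diff)
    (intro norm_pair_le norm_window_conv_le continuous_on_kernels continuous_on_H x y assms
      norm_kernels_le continuous_on_diff | simp)+

text \<open>Evaluation at a fixed time is nonexpansive for the supremum distance; this makes
  periodicity a closed condition.\<close>

lemma continuous_on_apply_snd:
  fixes S :: "('a::metric_space \<times> (real \<Rightarrow>\<^sub>C ('b::metric_space))) set"
  shows "continuous_on S (\<lambda>p. apply_bcontfun (snd p) t)"
proof -
  have "dist (apply_bcontfun (snd p) t) (apply_bcontfun (snd q) t) \<le> dist p q" for p q :: "'a \<times> (real \<Rightarrow>\<^sub>C 'b)"
    using order_trans[OF dist_bounded dist_snd_le] .
  then show ?thesis unfolding continuous_on_iff by (meson order_le_less_trans)
qed

text \<open>For \<open>\<epsilon> = \<mu> \<nu>\<close> with \<open>\<bar>\<nu>\<bar> = \<mu> = \<surd>\<bar>\<epsilon>\<bar>\<close>, the perturbation of the orbit is written as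
  \<open>\<mu> w\<close>. This balances the two off-diagonal Lipschitz constants: both the influence of \<open>w\<close> on \<open>z\<close>
  and the influence of \<open>z\<close> on \<open>w\<close> become \<open>O(\<mu>)\<close>.\<close>

theorem periodic_response:
  assumes inj: "inj (resonance_deriv z0)" and zero: "resonance (orbit z0) = 0"
  obtains Q \<mu>0 where "Q \<ge> 0" "\<mu>0 > 0"
    "\<And>\<mu> \<nu>. 0 \<le> \<mu> \<Longrightarrow> \<mu> \<le> \<mu>0 \<Longrightarrow> \<bar>\<nu>\<bar> = \<mu> \<Longrightarrow> \<exists>z w. continuous_on UNIV w \<and> (\<forall>t. w (t + T) = w t) \<and>
       resonance (\<lambda>t. orbit z t + \<mu> *\<^sub>R w t) = 0 \<and>
       (\<forall>t. w t = \<nu> *\<^sub>R response (\<lambda>t. orbit z t + \<mu> *\<^sub>R w t) t) \<and>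
       norm (z - z0) \<le> Q * \<mu> \<and> (\<forall>t. norm (w t) \<le> Q * \<mu>)"
proof -
  let ?M = "resonance_deriv z0"
  \<comment> \<open>\<open>N\<close> inverts the derivative at \<open>z0\<close> and stays fixed
    during the iteration, as in the simplified Newton method.\<close>
  obtain N where N: "linear N" "\<And>v. N (?M v) = v" "\<And>v. ?M (N v) = v"
    using linear_injective_isomorphism[OF linear_resonance_deriv inj] by blast
  obtain K where K: "K > 0" "\<And>v. norm (N v) \<le> norm v * K"
    using bounded_linear.pos_bounded N(1) linear_conv_bounded_linear by blast
  obtain B where B: "B \<ge> 0" "\<And>\<kappa>. \<kappa> > 0 \<Longrightarrow> \<exists>r>0. \<forall>x y v \<delta>.
       continuous_on UNIV x \<longrightarrow> continuous_on UNIV y \<longrightarrow>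
       (\<forall>s\<in>{0..T}. x s \<in> cball (orbit z0 s) r \<and> y s \<in> cball (orbit z0 s) r \<and>
          norm (x s - y s - orbit v s) \<le> \<delta>) \<longrightarrow>
       norm (resonance x - resonance y - resonance_deriv z0 v) \<le> T * (\<kappa> * (norm v + \<delta>) + B * \<delta>)"
    using resonance_strict[of z0] by metis
  \<comment> \<open>Makes the share of \<kappa> in the Newton error,
    \<open>K * T * (\<kappa> * (d + d))\<close>, equal to \<open>1/8 * d\<close>.\<close>
  define \<kappa> where "\<kappa> = 1 / (16 * K * T)"
  have \<kappa>: "\<kappa> > 0" using K(1) T_pos by (simp add: \<kappa>_def)
  obtain r0 where "r0 > 0" and r0': "\<forall>x y v \<delta>.
       continuous_on UNIV x \<longrightarrow> continuous_on UNIV y \<longrightarrow>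
       (\<forall>s\<in>{0..T}. x s \<in> cball (orbit z0 s) r0 \<and> y s \<in> cball (orbit z0 s) r0 \<and>
          norm (x s - y s - orbit v s) \<le> \<delta>) \<longrightarrow>
       norm (resonance x - resonance y - ?M v) \<le> T * (\<kappa> * (norm v + \<delta>) + B * \<delta>)"
    using B(2)[OF \<kappa>] by (elim exE conjE)
  have r0: "norm (resonance x - resonance y - ?M v) \<le> T * (\<kappa> * (norm v + \<delta>) + B * \<delta>)"
    if "continuous_on UNIV x" "continuous_on UNIV y"
      "\<And>s. s \<in> {0..T} \<Longrightarrow> x s \<in> cball (orbit z0 s) r0"
      "\<And>s. s \<in> {0..T} \<Longrightarrow> y s \<in> cball (orbit z0 s) r0"
      "\<And>s. s \<in> {0..T} \<Longrightarrow> norm (x s - y s - orbit v s) \<le> \<delta>" for x y v \<delta>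
    using r0'[rule_format, OF that(1,2)] that(3-5) by blast
  obtain r1 L1 where r1: "r1 > 0" "L1 \<ge> 0"
    "\<And>s x y. x \<in> cball (orbit z0 s) r1 \<Longrightarrow> y \<in> cball (orbit z0 s) r1 \<Longrightarrow>
       norm (H1 (s, x) - H1 (s, y)) \<le> L1 * norm (x - y)"
    using uniform_lipschitz_near_curve[OF deriv(1) cont_deriv(1) continuous_on_orbit T_pos per(1) orbit_per]
    by metis
  obtain r2 L2 where r2: "r2 > 0" "L2 \<ge> 0"
    "\<And>s x y. x \<in> cball (orbit z0 s) r2 \<Longrightarrow> y \<in> cball (orbit z0 s) r2 \<Longrightarrow>
       norm (H2 (s, x) - H2 (s, y)) \<le> L2 * norm (x - y)"
    using uniform_lipschitz_near_curve[OF deriv(2) cont_deriv(2) continuous_on_orbit T_pos per(2) orbit_per]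
    by metis
  define r where "r = min r0 (min r1 r2)"
  define L where "L = max L1 L2"
  have r: "r > 0" "r \<le> r0" "r \<le> r1" "r \<le> r2" using \<open>r0 > 0\<close> r1 r2 by (auto simp: r_def)
  have L: "L \<ge> 0" "L1 \<le> L" "L2 \<le> L" using r1 r2 by (auto simp: L_def)
  have lip1: "norm (H1 (s, x) - H1 (s, y)) \<le> L * norm (x - y)"
    if "x \<in> cball (orbit z0 s) r" "y \<in> cball (orbit z0 s) r" for s x y
    using that r by (intro order_trans[OF r1(3) mult_right_mono[OF L(2)]]) auto
  have lip2: "norm (H2 (s, x) - H2 (s, y)) \<le> L * norm (x - y)"
    if "x \<in> cball (orbit z0 s) r" "y \<in> cball (orbit z0 s) r" for s x y
    using that r by (intro order_trans[OF r2(3) mult_right_mono[OF L(3)]]) auto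
  obtain h where h: "h \<ge> 0" "\<And>s. norm (H1 (s, orbit z0 s)) \<le> h" "\<And>s. norm (H2 (s, orbit z0 s)) \<le> h"
  proof -
    have bounded: "\<exists>h. \<forall>s. norm (f s) \<le> h"
      if "continuous_on UNIV f" "\<And>s. f (s + T) = f s" for f :: "real \<Rightarrow> complex"
    proof -
      have "compact (f ` {0..T})"
        by (intro compact_continuous_image continuous_on_subset[OF that(1)]) auto
      then obtain h where h: "\<And>s. s \<in> {0..T} \<Longrightarrow> norm (f s) \<le> h"
        by (meson bounded_iff compact_imp_bounded image_eqI)
      have "norm (f s) \<le> h" for s
        by (rule periodic_all[OF T_pos, of "\<lambda>s. norm (f s) \<le> h"]) (use h in \<open>simp_all add: that(2)\<close>)
      then show ?thesis by blast
    qed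
    obtain h1 where h1: "\<And>s. norm (H1 (s, orbit z0 s)) \<le> h1"
      using bounded[OF continuous_on_H(1)[OF continuous_on_orbit[of _ z0]]] per by auto
    obtain h2 where h2: "\<And>s. norm (H2 (s, orbit z0 s)) \<le> h2"
      using bounded[OF continuous_on_H(2)[OF continuous_on_orbit[of _ z0]]] per by auto
    show ?thesis
    proof
      show "max h1 h2 \<ge> 0" using order_trans[OF norm_ge_zero h1] by simp
    qed (use h1 h2 in \<open>auto simp: le_max_iff_disj\<close>)
  qed
  \<comment> \<open>\<open>Q * \<mu>\<close> bounds the first step of the iteration, which consists
    only of the response to the unperturbed orbit since the resonance vanishes there.\<close>
  define Q where "Q = 2 * (T * kernel_bound * h)"
  have Q: "Q \<ge> 0" using h(1) T_pos kernel_bound_pos by (simp add: Q_def)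
  define P where "P = K * T * B"
  define R where "R = T * kernel_bound * L"
  have PR: "P \<ge> 0" "R \<ge> 0" using K(1) T_pos kernel_bound_pos L(1) B(1) by (simp_all add: P_def R_def)
  \<comment> \<open>All summands are nonnegative, so \<open>\<mu> * V \<le> 1\<close> bounds each
    product separately: 1 gives \<open>\<mu> \<le> 1\<close>, \<open>4 * Q / r\<close> keeps the
    iterates in the tube of radius \<open>r\<close>, and the last two make the couplings between
    \<open>z\<close> and \<open>w\<close> small.\<close>
  define V where "V = 1 + 4 * Q / r + 8 * P + 16 * R"
  have V: "V \<ge> 1" using Q r(1) PR by (simp add: V_def)
  show ?thesis
  proof (rule that[of "2 * Q" "1 / V"])
    show "2 * Q \<ge> 0" "1 / V > 0" using Q V by auto
    fix \<mu> \<nu> :: real assume \<mu>: "0 \<le> \<mu>" "\<mu> \<le> 1 / V" and \<nu>: "\<bar>\<nu>\<bar> = \<mu>"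
    have \<mu>V: "\<mu> * V \<le> 1" using \<mu>(2) V by (simp add: field_simps)
    have small: "\<mu> \<le> 1" "4 * (Q * \<mu>) \<le> r" "P * \<mu> \<le> 1/8" "R * \<mu> \<le> 1/16"
    proof -
      have e: "\<mu> + \<mu> * (4 * Q / r) + \<mu> * (8 * P) + \<mu> * (16 * R) \<le> 1"
        using \<mu>V by (simp add: V_def algebra_simps)
      have nn: "\<mu> * (4 * Q / r) \<ge> 0" "\<mu> * (8 * P) \<ge> 0" "\<mu> * (16 * R) \<ge> 0" using \<mu>(1) Q r(1) PR by simp_all
      show "\<mu> \<le> 1" using e nn by linarith
      have "\<mu> * (4 * Q / r) \<le> 1" using e nn \<mu>(1) by linarith
      then show "4 * (Q * \<mu>) \<le> r" using r(1) by (simp add: field_simps)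
      show "P * \<mu> \<le> 1/8" using e nn \<mu>(1) by (simp add: mult.commute[of \<mu>])
      show "R * \<mu> \<le> 1/16" using e nn \<mu>(1) by (simp add: mult.commute[of \<mu>])
    qed
    define p0 :: "complex \<times> (real \<Rightarrow>\<^sub>C (complex \<times> complex))" where "p0 = (z0, 0)"
    define S :: "(complex \<times> (real \<Rightarrow>\<^sub>C (complex \<times> complex))) set"
      where "S = {p. \<forall>t. apply_bcontfun (snd p) (t + T) = apply_bcontfun (snd p) t}"
    define X :: "complex \<times> (real \<Rightarrow>\<^sub>C (complex \<times> complex)) \<Rightarrow> real \<Rightarrow> complex \<times> complex"
      where "X p t = orbit (fst p) t + \<mu> *\<^sub>R apply_bcontfun (snd p) t" for p t
    \<comment> \<open>A Newton step for the resonance equation, paired with the response equation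
      for \<open>w\<close>. \<open>Bcontfun\<close> is meaningful only for bounded continuous
      functions; \<open>app\<close> establishes this on the ball.\<close>
    define f :: "complex \<times> (real \<Rightarrow>\<^sub>C (complex \<times> complex)) \<Rightarrow> complex \<times> (real \<Rightarrow>\<^sub>C (complex \<times> complex))"
      where "f p = (fst p - N (resonance (X p)), Bcontfun (\<lambda>t. \<nu> *\<^sub>R response (X p) t))" for p
    have X_cont: "continuous_on UNIV (X p)" for p
      unfolding X_def[abs_def] by (intro continuous_intros continuous_on_apply_bcontfun)
    have X_p0: "X p0 = orbit z0" by (simp add: X_def[abs_def] p0_def)
    have X_per: "X p (t + T) = X p t" if "p \<in> S" for p t using that by (simp add: X_def S_def)
    \<comment> \<open>The change of \<open>z\<close> and the correction
      \<open>\<mu> *\<^sub>R w\<close> each contribute at most \<open>2 * (Q * \<mu>)\<close>, the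
      latter by \<open>\<mu> \<le> 1\<close>; hence the 4 in \<open>V\<close>.\<close>
    have near: "X p t \<in> cball (orbit z0 t) r" "norm (fst p - z0) \<le> 2 * (Q * \<mu>)" "norm (apply_bcontfun (snd p) t) \<le> 2 * (Q * \<mu>)"
      if "dist p p0 \<le> 2 * (Q * \<mu>)" for p t
    proof -
      show z: "norm (fst p - z0) \<le> 2 * (Q * \<mu>)"
        using dist_fst_le[of p p0] that by (simp add: p0_def dist_norm)
      have "dist (apply_bcontfun (snd p) t) (apply_bcontfun (snd p0) t) \<le> dist p p0"
        using order_trans[OF dist_bounded dist_snd_le] .
      then show w: "norm (apply_bcontfun (snd p) t) \<le> 2 * (Q * \<mu>)" using that by (simp add: p0_def dist_norm)
      have "norm (X p t - orbit z0 t) \<le> norm (orbit (fst p - z0) t) + norm (\<mu> *\<^sub>R apply_bcontfun (snd p) t)"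
        unfolding X_def
        by (rule order_trans[OF _ norm_triangle_ineq]) (simp add: orbit_diff[symmetric] algebra_simps)
      also have "\<dots> \<le> 2 * (Q * \<mu>) + 1 * (2 * (Q * \<mu>))"
        using z w \<mu>(1) small(1) unfolding norm_orbit norm_scaleR by (intro add_mono mult_mono) auto
      also have "\<dots> \<le> r" using small(2) by simp
      finally show "X p t \<in> cball (orbit z0 t) r" by (simp add: dist_norm norm_minus_commute)
    qed
    have orbit_near: "orbit z0 s \<in> cball (orbit z0 s) r" for s using r(1) by simp
    have app: "apply_bcontfun (Bcontfun (\<lambda>t. \<nu> *\<^sub>R response (X p) t)) t = \<nu> *\<^sub>R response (X p) t"
      if p: "dist p p0 \<le> 2 * (Q * \<mu>)" for p t
    proof -
      have norm_le: "norm u \<le> L * r + h" if "norm (u - v) \<le> L * norm (X p s - orbit z0 s)" "norm v \<le> h"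
        for u v :: complex and s
      proof -
        have "norm (X p s - orbit z0 s) \<le> r" using near(1)[OF p, of s] by (simp add: dist_norm norm_minus_commute)
        then have "L * norm (X p s - orbit z0 s) \<le> L * r" using L(1) by (rule mult_left_mono)
        then show ?thesis using that norm_triangle_sub[of u v] by linarith
      qed
      have "norm (H1 (s, X p s)) \<le> L * r + h" "norm (H2 (s, X p s)) \<le> L * r + h" for s
        using norm_le[OF lip1[OF near(1)[OF p] orbit_near]] norm_le[OF lip2[OF near(1)[OF p] orbit_near]] h by auto
      then have "norm (response (X p) t) \<le> 2 * (T * kernel_bound * (L * r + h))" for t
        by (intro norm_response_le X_cont)
      then have "norm (\<nu> *\<^sub>R response (X p) t) \<le> \<bar>\<nu>\<bar> * (2 * (T * kernel_bound * (L * r + h)))" for t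
        by (simp add: mult_left_mono)
      then have "(\<lambda>t. \<nu> *\<^sub>R response (X p) t) \<in> bcontfun"
        by (intro bcontfun_normI) (auto intro!: continuous_intros response_continuous X_cont)
      then show ?thesis by (simp add: Bcontfun_inverse)
    qed
    obtain p where p: "p \<in> S" "dist p p0 \<le> 2 * (Q * \<mu>)" "f p = p"
    proof (rule Banach_fix_ball[of S p0 f "Q * \<mu>"])
      have "S = (\<Inter>t. {p. apply_bcontfun (snd p) (t + T) = apply_bcontfun (snd p) t})" by (auto simp: S_def)
      also have "closed \<dots>"
        by (intro closed_INT ballI closed_Collect_eq continuous_on_apply_snd)
      finally show "closed S" .
      show p0S: "p0 \<in> S" by (simp add: S_def p0_def)
      have p0: "dist p0 p0 \<le> 2 * (Q * \<mu>)" using Q \<mu>(1) by simp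
      have "norm (\<nu> *\<^sub>R response (X p0) t) \<le> Q * \<mu>" for t
        using norm_response_le[OF continuous_on_orbit h(2,3), of t] \<mu>(1) \<nu>
        by (simp add: X_p0 Q_def mult.commute[of \<mu>] mult_right_mono)
      then have "dist (Bcontfun (\<lambda>t. \<nu> *\<^sub>R response (X p0) t)) 0 \<le> Q * \<mu>"
        by (intro dist_bound) (simp add: app[OF p0] dist_norm)
      moreover have "N 0 = 0" using N(1) by (rule linear_0)
      ultimately show "dist (f p0) p0 \<le> Q * \<mu>"
        unfolding f_def X_p0 zero by (simp add: p0_def dist_Pair_Pair X_p0 zero)
    next
      fix p assume "p \<in> S" "dist p p0 \<le> 2 * (Q * \<mu>)"
      then show "f p \<in> S"
        using response_periodic[of "X p"] X_per by (simp add: S_def f_def app)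
    next
      fix p q assume "p \<in> S" "q \<in> S" and p: "dist p p0 \<le> 2 * (Q * \<mu>)" and q: "dist q p0 \<le> 2 * (Q * \<mu>)"
      define d where "d = dist p q"
      have d0: "d \<ge> 0" by (simp add: d_def)
      have z: "norm (fst p - fst q) \<le> d" using dist_fst_le[of p q] by (simp add: d_def dist_norm)
      have w: "norm (apply_bcontfun (snd p) t - apply_bcontfun (snd q) t) \<le> d" for t
        using order_trans[OF dist_bounded dist_snd_le, of p t q] by (simp add: d_def dist_norm)
      have rest: "X p t - X q t - orbit (fst p - fst q) t = \<mu> *\<^sub>R (apply_bcontfun (snd p) t - apply_bcontfun (snd q) t)" for t
        by (simp add: X_def orbit_diff[symmetric] scaleR_diff_right)
      have rest_le: "norm (X p t - X q t - orbit (fst p - fst q) t) \<le> \<mu> * d" for t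
        unfolding rest using \<mu>(1) w by (simp add: mult_left_mono)
      let ?v = "fst p - fst q"
      \<comment> \<open>By \<open>rest_le\<close> the strict estimate applies with
        \<open>\<delta> = \<mu> * d\<close>: the influence of \<open>w\<close> on the resonance
        carries a factor \<mu>.\<close>
      have "norm (resonance (X p) - resonance (X q) - ?M ?v) \<le> T * (\<kappa> * (norm ?v + \<mu> * d) + B * (\<mu> * d))"
        by (intro r0 X_cont rest_le subsetD[OF subset_cball[OF r(2)]] near(1)[OF p] near(1)[OF q])
      also have "\<dots> \<le> T * (\<kappa> * (d + 1 * d) + B * (\<mu> * d))"
        using T_pos \<kappa> z small(1) d0 \<mu>(1) B(1) by (intro mult_left_mono add_mono mult_right_mono) auto
      finally have "K * norm (resonance (X p) - resonance (X q) - ?M ?v)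
          \<le> K * (T * (\<kappa> * (d + 1 * d) + B * (\<mu> * d)))" using K(1) by simp
      also have "\<dots> = 1/8 * d + (P * \<mu>) * d"
        using K(1) T_pos by (simp add: \<kappa>_def P_def field_simps)
      also have "\<dots> \<le> 1/8 * d + 1/8 * d" using small(3) d0 by (intro add_mono mult_right_mono) auto
      finally have K_le: "K * norm (resonance (X p) - resonance (X q) - ?M ?v) \<le> 1/4 * d" by simp
      \<comment> \<open>The Newton step cancels the linear part \<open>?v\<close>, so only the
        strict differentiability error remains.\<close>
      have "fst (f p) - fst (f q) = - N (resonance (X p) - resonance (X q) - ?M ?v)"
        by (simp add: f_def linear_diff[OF N(1)] N(2))
      then have "norm (fst (f p) - fst (f q)) \<le> K * norm (resonance (X p) - resonance (X q) - ?M ?v)"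
        using K(2) by (simp add: mult.commute)
      with K_le have first: "dist (fst (f p)) (fst (f q)) \<le> 1/4 * d" by (simp add: dist_norm)
      have X_le: "norm (X p t - X q t) \<le> 2 * d" for t
      proof -
        have "\<mu> * d \<le> 1 * d" using small(1) d0 by (rule mult_right_mono)
        then show ?thesis
          using norm_triangle_sub[of "X p t - X q t" "orbit ?v t"] rest_le[of t] z by simp
      qed
      \<comment> \<open>The bound equals \<open>4 * R * d\<close>; the factor \<nu> in front of the
        response then brings it down to \<open>1/4 * d\<close>.\<close>
      have "norm (response (X p) t - response (X q) t) \<le> 2 * (T * kernel_bound * (L * (2 * d)))" for t
        by (intro norm_response_diff_le X_cont order_trans[OF lip1 mult_left_mono[OF X_le L(1)]]
            order_trans[OF lip2 mult_left_mono[OF X_le L(1)]] near(1)[OF p] near(1)[OF q])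
      then have "\<mu> * norm (response (X p) t - response (X q) t) \<le> \<mu> * (2 * (T * kernel_bound * (L * (2 * d))))" for t
        using \<mu>(1) by (rule mult_left_mono)
      also have "\<mu> * (2 * (T * kernel_bound * (L * (2 * d)))) = 4 * (R * \<mu>) * d" by (simp add: R_def)
      also have "\<dots> \<le> 4 * (1/16) * d" using small(4) d0 by (intro mult_right_mono) auto
      finally have "\<mu> * norm (response (X p) t - response (X q) t) \<le> 1/4 * d" for t by simp
      then have second: "dist (snd (f p)) (snd (f q)) \<le> 1/4 * d"
        by (intro dist_bound) (simp add: f_def app[OF p] app[OF q] dist_norm \<nu> flip: scaleR_diff_right)
      have "dist (f p) (f q) \<le> dist (fst (f p)) (fst (f q)) + dist (snd (f p)) (snd (f q))"
        unfolding dist_prod_def by (rule sqrt_sum_squares_le_sum) auto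
      then show "dist (f p) (f q) \<le> 1/2 * dist p q" using first second by (simp add: d_def)
    qed
    let ?w = "apply_bcontfun (snd p)"
    have X_eq: "(\<lambda>t. orbit (fst p) t + \<mu> *\<^sub>R ?w t) = X p" by (simp add: X_def[abs_def])
    \<comment> \<open>At a fixed point the Newton step is zero, and \<open>N\<close> is
      invertible.\<close>
    have "N (resonance (X p)) = 0" using arg_cong[OF p(3), of fst] by (simp add: f_def)
    then have "resonance (X p) = 0" using N(3)[of "resonance (X p)"] linear_0[OF linear_resonance_deriv] by simp
    moreover have "?w t = \<nu> *\<^sub>R response (X p) t" for t
      using arg_cong[OF p(3), of "\<lambda>q. apply_bcontfun (snd q) t"] by (simp add: f_def app[OF p(2)])
    moreover have "?w (t + T) = ?w t" for t using p(1) unfolding S_def by blast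
    moreover have "continuous_on UNIV ?w" by (rule continuous_on_apply_bcontfun)
    ultimately show "\<exists>z w. continuous_on UNIV w \<and> (\<forall>t. w (t + T) = w t) \<and>
       resonance (\<lambda>t. orbit z t + \<mu> *\<^sub>R w t) = 0 \<and>
       (\<forall>t. w t = \<nu> *\<^sub>R response (\<lambda>t. orbit z t + \<mu> *\<^sub>R w t) t) \<and>
       norm (z - z0) \<le> 2 * Q * \<mu> \<and> (\<forall>t. norm (w t) \<le> 2 * Q * \<mu>)"
      using near(2,3)[OF p(2)] unfolding mult.assoc
      by - (rule exI[of _ "fst p"], rule exI[of _ ?w], unfold X_eq, intro conjI allI)
  qed
qed

section \<open>From the fixed point to solutions of the mode equations\<close>

lemma cis_neg_has_vector_derivative:
  "((\<lambda>s. cis (- (c * s))) has_vector_derivative - (\<i> * c * cis (- (c * s)))) (at s)"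
  using cis_has_vector_derivative[of "- c" s] by simp

text \<open>The kernel grows from 0 to 1 over the window, so the boundary terms give
  \<open>H1 (t, x t)\<close>. Its derivative is \<open>- \<i> * a\<close> times the kernel plus a
  multiple of \<open>cis (- (a * s))\<close>, and the convolution with that extra term vanishes
  together with the resonance.\<close>

lemma resonant_mode_derivative:
  assumes x: "continuous_on UNIV x" and x_per: "\<And>t. x (t + T) = x t" and zero: "resonance x = 0"
  shows "(window_conv T resonant_kernel (\<lambda>s. H1 (s, x s)) has_vector_derivative
    \<i> * a * window_conv T resonant_kernel (\<lambda>s. H1 (s, x s)) t + H1 (t, x t)) (at t)"
proof -
  let ?h = "\<lambda>s. H1 (s, x s)" and ?c = "\<lambda>s. cis (- (a * s))"
  have h: "continuous_on UNIV ?h" and h_per: "?h (t + T) = ?h t" for t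
    using x x_per per by (simp_all add: continuous_on_H)
  have c: "continuous_on UNIV ?c" by (intro continuous_intros)
  have cT: "?c T = 1" using res by (simp add: complex_eq_iff)
  have cis_deriv: "(?c has_vector_derivative - (\<i> * a * ?c s)) (at s)" for s
    by (rule cis_neg_has_vector_derivative)
  have scale: "window_conv T (\<lambda>s. d * k s) ?h t = d * window_conv T k ?h t" for d k t
    by (simp add: window_conv_def mult.assoc)
  \<comment> \<open>\<open>J\<close> solves the free equation of the first mode, hence is determined
    by \<open>J 0\<close>, which is the resonance.\<close>
  define J where "J = window_conv T ?c ?h"
  have "(J has_vector_derivative \<i> * a * J s) (at s)" for s
    using window_conv_has_vector_derivative[OF less_imp_le[OF T_pos] cis_deriv _ h, of s]
      scale[of "- (\<i> * a)" ?c s] h_per[of s] cT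
    by (simp add: J_def continuous_intros)
  from has_vector_derivative_mult[OF cis_deriv this]
  have "((\<lambda>s. ?c s * J s) has_vector_derivative 0) (at s within UNIV)" for s
    by (rule has_vector_derivative_eq_rhs) (simp add: algebra_simps)
  then obtain d where d: "\<And>s. ?c s * J s = d"
    using has_vector_derivative_zero_constant[of UNIV "\<lambda>s. ?c s * J s"] by auto
  have "J 0 = 0" using zero by (simp add: J_def window_conv_def resonance_def)
  with d[of 0] d have J0: "J s = 0" for s by (metis cis_neq_zero mult_eq_0_iff)
  let ?k' = "\<lambda>s. of_real (1 / T) * ?c s - \<i> * a * resonant_kernel s"
  have kernel_deriv: "(resonant_kernel has_vector_derivative ?k' s) (at s)" for s
  proof -
    have "((\<lambda>s. complex_of_real (s / T)) has_vector_derivative of_real (1 / T)) (at s)"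
      using T_pos by (intro has_vector_derivative_of_real derivative_eq_intros) auto
    from has_vector_derivative_mult[OF this cis_deriv[of s]] show ?thesis
      unfolding resonant_kernel_def[abs_def]
      by (rule has_vector_derivative_eq_rhs) (simp add: algebra_simps)
  qed
  have "window_conv T ?k' ?h t =
      window_conv T (\<lambda>s. of_real (1 / T) * ?c s) ?h t - window_conv T (\<lambda>s. \<i> * a * resonant_kernel s) ?h t"
    unfolding window_conv_def left_diff_distrib
    by (intro integral_diff window_conv_integrable continuous_intros c h continuous_on_kernels)
  also have "\<dots> = - (\<i> * a * window_conv T resonant_kernel ?h t)"
    unfolding scale using J0[of t] by (simp add: J_def)
  finally have "window_conv T ?k' ?h t = - (\<i> * a * window_conv T resonant_kernel ?h t)" .
  moreover have "continuous_on UNIV ?k'" by (intro continuous_intros continuous_on_kernels)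
  moreover have "resonant_kernel T = 1" "resonant_kernel 0 = 0"
    using T_pos cT by (simp_all add: resonant_kernel_def)
  ultimately show ?thesis
    using window_conv_has_vector_derivative[OF less_imp_le[OF T_pos] kernel_deriv _ h, of t] h_per[of t]
    by (simp add: add.commute)
qed

text \<open>The kernel satisfies \<open>k' = - \<i> * b * k\<close> exactly, and its denominator is
  chosen so that \<open>k T - k 0 = 1\<close>; for a periodic forcing the boundary terms therefore
  give \<open>H2 (t, x t)\<close>.\<close>

lemma nonresonant_mode_derivative:
  assumes x: "continuous_on UNIV x" and x_per: "\<And>t. x (t + T) = x t"
  shows "(window_conv T nonresonant_kernel (\<lambda>s. H2 (s, x s)) has_vector_derivative
    \<i> * b * window_conv T nonresonant_kernel (\<lambda>s. H2 (s, x s)) t + H2 (t, x t)) (at t)"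
proof -
  let ?h = "\<lambda>s. H2 (s, x s)"
  have h: "continuous_on UNIV ?h" and h_per: "?h (t + T) = ?h t"
    using x x_per per by (simp_all add: continuous_on_H)
  let ?k' = "\<lambda>s. - (\<i> * b) * nonresonant_kernel s"
  have kernel_deriv: "(nonresonant_kernel has_vector_derivative ?k' s) (at s)" for s
    using has_vector_derivative_divide[OF cis_neg_has_vector_derivative[of b s]]
    by (simp add: nonresonant_kernel_def[abs_def])
  have "cis (- (b * T)) \<noteq> 1" using nonres by (simp add: complex_eq_iff)
  then have jump: "nonresonant_kernel T - nonresonant_kernel 0 = 1"
    by (simp add: nonresonant_kernel_def diff_divide_distrib[symmetric])
  have "window_conv T ?k' ?h t = - (\<i> * b) * window_conv T nonresonant_kernel ?h t"
    unfolding window_conv_def mult.assoc integral_mult_right ..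
  moreover have "continuous_on UNIV ?k'" by (intro continuous_intros continuous_on_kernels)
  moreover have "nonresonant_kernel T * ?h (t + T) - nonresonant_kernel 0 * ?h t = ?h t"
    unfolding h_per left_diff_distrib[symmetric] jump by simp
  ultimately show ?thesis
    using window_conv_has_vector_derivative[OF less_imp_le[OF T_pos] kernel_deriv _ h, of t]
    by (simp add: add.commute)
qed

definition mode_solution :: "real \<Rightarrow> (real \<Rightarrow> complex \<times> complex) \<Rightarrow> bool" where
  "mode_solution \<epsilon> x \<longleftrightarrow> (\<forall>t. x (t + T) = x t \<and>
     ((\<lambda>t. fst (x t)) has_vector_derivative \<i> * a * fst (x t) + \<epsilon> *\<^sub>R H1 (t, x t)) (at t) \<and>
     ((\<lambda>t. snd (x t)) has_vector_derivative \<i> * b * snd (x t) + \<epsilon> *\<^sub>R H2 (t, x t)) (at t))"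

text \<open>Undoes the scaling of the fixed point problem. The rate
  \<open>sqrt \<bar>\<epsilon>\<bar>\<close> comes from the bound on \<open>z - z0\<close>, which is
  of order \<mu>.\<close>

theorem ex_mode_solution:
  assumes inj: "inj (resonance_deriv z0)" and zero: "resonance (orbit z0) = 0"
  obtains C \<epsilon>0 where "\<epsilon>0 > 0"
    "\<And>\<epsilon>. \<bar>\<epsilon>\<bar> < \<epsilon>0 \<Longrightarrow> \<exists>x. mode_solution \<epsilon> x \<and> (\<forall>t. norm (x t - orbit z0 t) \<le> C * sqrt \<bar>\<epsilon>\<bar>)"
proof -
  obtain Q \<mu>0 where Q: "Q \<ge> 0" "\<mu>0 > 0" and ex:
    "\<And>\<mu> \<nu>. 0 \<le> \<mu> \<Longrightarrow> \<mu> \<le> \<mu>0 \<Longrightarrow> \<bar>\<nu>\<bar> = \<mu> \<Longrightarrow> \<exists>z w. continuous_on UNIV w \<and> (\<forall>t. w (t + T) = w t) \<and>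
       resonance (\<lambda>t. orbit z t + \<mu> *\<^sub>R w t) = 0 \<and>
       (\<forall>t. w t = \<nu> *\<^sub>R response (\<lambda>t. orbit z t + \<mu> *\<^sub>R w t) t) \<and>
       norm (z - z0) \<le> Q * \<mu> \<and> (\<forall>t. norm (w t) \<le> Q * \<mu>)"
    using periodic_response[OF inj zero] by blast
  show ?thesis
  proof
    show "\<mu>0\<^sup>2 > 0" using Q by simp
    fix \<epsilon> :: real assume \<epsilon>: "\<bar>\<epsilon>\<bar> < \<mu>0\<^sup>2"
    define \<mu> where "\<mu> = sqrt \<bar>\<epsilon>\<bar>"
    \<comment> \<open>\<open>\<nu>\<close> carries the sign of \<epsilon>, so that
      \<open>\<mu> * \<nu> = \<epsilon>\<close> for both signs.\<close>
    define \<nu> where "\<nu> = sgn \<epsilon> * \<mu>"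
    have \<mu>: "0 \<le> \<mu>" "\<mu> \<le> \<mu>0" using \<epsilon> Q(2) real_sqrt_less_mono[OF \<epsilon>] by (simp_all add: \<mu>_def)
    have \<nu>: "\<bar>\<nu>\<bar> = \<mu>" "\<mu> * \<nu> = \<epsilon>" by (simp_all add: \<nu>_def \<mu>_def abs_mult sgn_real_def)
    obtain z w where w: "continuous_on UNIV w" "\<And>t. w (t + T) = w t"
       "resonance (\<lambda>t. orbit z t + \<mu> *\<^sub>R w t) = 0"
       "\<And>t. w t = \<nu> *\<^sub>R response (\<lambda>t. orbit z t + \<mu> *\<^sub>R w t) t"
       "norm (z - z0) \<le> Q * \<mu>" "\<And>t. norm (w t) \<le> Q * \<mu>"
      using ex[OF \<mu> \<nu>(1)] by blast
    define x where "x t = orbit z t + \<mu> *\<^sub>R w t" for t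
    have x: "continuous_on UNIV x" "\<And>t. x (t + T) = x t" "resonance x = 0"
      using w(1-3) by (auto simp: x_def[abs_def] intro!: continuous_intros)
    \<comment> \<open>The two scalings combine to \<epsilon>, so each mode is a free oscillation,
      zero for the second mode, plus \<epsilon> times its convolution.\<close>
    have x_eq: "x t = orbit z t + \<epsilon> *\<^sub>R response x t" for t
      using w(4)[of t] \<nu>(2) by (simp add: x_def[abs_def])
    have fst_eq: "fst (x t) = cis (a * t) * z + \<epsilon> *\<^sub>R window_conv T resonant_kernel (\<lambda>s. H1 (s, x s)) t" for t
      using x_eq[of t] by (simp add: orbit_def response_def prod_eq_iff)
    have snd_eq: "snd (x t) = \<epsilon> *\<^sub>R window_conv T nonresonant_kernel (\<lambda>s. H2 (s, x s)) t" for t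
      using x_eq[of t] by (simp add: orbit_def response_def prod_eq_iff)
    have "((\<lambda>t. fst (x t)) has_vector_derivative \<i> * a * fst (x t) + \<epsilon> *\<^sub>R H1 (t, x t)) (at t)" for t
      unfolding fst_eq
      by (rule has_vector_derivative_eq_rhs[OF has_vector_derivative_add[OF
            has_vector_derivative_mult_left[OF cis_has_vector_derivative]
            bounded_linear.has_vector_derivative[OF bounded_linear_scaleR_right resonant_mode_derivative[OF x]]]])
        (simp add: scaleR_conv_of_real algebra_simps)
    moreover have "((\<lambda>t. snd (x t)) has_vector_derivative \<i> * b * snd (x t) + \<epsilon> *\<^sub>R H2 (t, x t)) (at t)" for t
      unfolding snd_eq
      by (rule has_vector_derivative_eq_rhs[OF
            bounded_linear.has_vector_derivative[OF bounded_linear_scaleR_right nonresonant_mode_derivative[OF x(1,2)]]])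
        (simp add: scaleR_conv_of_real algebra_simps)
    ultimately have "mode_solution \<epsilon> x" using x(2) by (simp add: mode_solution_def)
    moreover have "norm (x t - orbit z0 t) \<le> (Q + \<mu>0 * Q) * sqrt \<bar>\<epsilon>\<bar>" for t
    proof -
      have "norm (x t - orbit z0 t) \<le> norm (orbit (z - z0) t) + norm (\<mu> *\<^sub>R w t)"
        unfolding x_def
        by (rule order_trans[OF _ norm_triangle_ineq]) (simp add: orbit_diff[symmetric] algebra_simps)
      also have "\<dots> \<le> Q * \<mu> + \<mu>0 * (Q * \<mu>)"
        using w(5,6) \<mu> unfolding norm_orbit norm_scaleR by (intro add_mono mult_mono) auto
      finally show ?thesis by (simp add: \<mu>_def algebra_simps)
    qed
    ultimately show "\<exists>x. mode_solution \<epsilon> x \<and> (\<forall>t. norm (x t - orbit z0 t) \<le> (Q + \<mu>0 * Q) * sqrt \<bar>\<epsilon>\<bar>)"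
      by blast
  qed
qed

end

subsection \<open>The modes of the double pendulum\<close>

definition \<omega>\<^sub>2 :: real where "\<omega>\<^sub>2 = sqrt (2 + sqrt 2)"

text \<open>The inverse of the passage to modes:
  \<open>u\<^sub>k = Im \<zeta>\<^sub>k / \<omega>\<^sub>k\<close> and
  \<open>u\<^sub>k' = Re \<zeta>\<^sub>k\<close>, while
  \<open>\<theta>\<^sub>1 = (u\<^sub>1 - u\<^sub>2) / (2 * sqrt 2)\<close> and
  \<open>\<theta>\<^sub>2 = (u\<^sub>1 + u\<^sub>2) / 2\<close>.\<close>

definition phase_of_modes :: "complex \<times> complex \<Rightarrow> phase" where
  "phase_of_modes \<zeta> =
    ((Im (fst \<zeta>) / \<omega>\<^sub>1 - Im (snd \<zeta>) / \<omega>\<^sub>2) / (2 * sqrt 2), (Re (fst \<zeta>) - Re (snd \<zeta>)) / (2 * sqrt 2),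
     (Im (fst \<zeta>) / \<omega>\<^sub>1 + Im (snd \<zeta>) / \<omega>\<^sub>2) / 2, (Re (fst \<zeta>) + Re (snd \<zeta>)) / 2)"

text \<open>The forcing is real since it enters only the equation for the velocity
  \<open>Re \<zeta>\<^sub>k\<close>. The factor \<open>c\<close> is the coefficient of
  \<open>\<theta>\<^sub>1\<close> in the mode, \<open>sqrt 2\<close> or
  \<open>- sqrt 2\<close>.\<close>

definition mode_force :: "real \<Rightarrow> (real \<times> phase \<Rightarrow> real) \<Rightarrow> (real \<times> phase \<Rightarrow> real) \<Rightarrow> real \<times> complex \<times> complex \<Rightarrow> complex" where
  "mode_force c F1 F2 p =
    of_real (c * F1 (fst p, phase_of_modes (snd p)) + F2 (fst p, phase_of_modes (snd p)))"

lemma sqrt2_bounds: "1 < sqrt (2::real)" "sqrt (2::real) < 2"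
  using real_less_rsqrt[of 1 2] real_less_lsqrt[of 2 2] by (simp_all add: power2_eq_square)

lemma \<omega>_pos: "\<omega>\<^sub>1 > 0" "\<omega>\<^sub>2 > 0"
  using sqrt2_bounds by (simp_all add: \<omega>\<^sub>1_def \<omega>\<^sub>2_def add_pos_pos)

lemma \<omega>_square: "\<omega>\<^sub>1 * \<omega>\<^sub>1 = 2 - sqrt 2" "\<omega>\<^sub>2 * \<omega>\<^sub>2 = 2 + sqrt 2"
  using sqrt2_bounds by (simp_all add: \<omega>\<^sub>1_def \<omega>\<^sub>2_def)

text \<open>Squaring reduces this to
  \<open>(1 + sqrt 2)\<^sup>2 * (2 - sqrt 2) = 2 + sqrt 2\<close>. The irrational ratio of the
  frequencies is what keeps the second mode out of resonance.\<close>

lemma \<omega>\<^sub>2_eq: "\<omega>\<^sub>2 = (1 + sqrt 2) * \<omega>\<^sub>1"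
proof (rule power2_eq_imp_eq)
  have "((1 + sqrt 2) * \<omega>\<^sub>1)\<^sup>2 = (1 + sqrt 2)\<^sup>2 * (\<omega>\<^sub>1 * \<omega>\<^sub>1)"
    by (simp add: power2_eq_square)
  then show "\<omega>\<^sub>2\<^sup>2 = ((1 + sqrt 2) * \<omega>\<^sub>1)\<^sup>2"
    by (simp add: power2_eq_square[of \<omega>\<^sub>2] \<omega>_square power2_eq_square algebra_simps)
qed (use \<omega>_pos in auto)

lemma sqrt_4: "sqrt (4 - 2 * sqrt 2) = sqrt 2 * \<omega>\<^sub>1"
  unfolding \<omega>\<^sub>1_def real_sqrt_mult[symmetric] by (simp add: algebra_simps)

lemma sqrt2_irrational: "sqrt 2 \<notin> \<rat>"
proof
  assume "sqrt 2 \<in> \<rat>"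
  then obtain m n :: nat where n: "n \<noteq> 0" and mn: "\<bar>sqrt 2\<bar> = real m / real n" and "coprime m n"
    by (rule Rats_abs_nat_div_natE)
  have "real m = sqrt 2 * real n" using mn n by (simp add: field_simps)
  then have "real (m\<^sup>2) = real (2 * n\<^sup>2)" by (simp add: power_mult_distrib)
  then have eq: "m\<^sup>2 = 2 * n\<^sup>2" by (simp only: of_nat_eq_iff)
  then have "even m" by (metis dvd_triv_left even_power)
  then obtain k where k: "m = 2 * k" by blast
  then have "n\<^sup>2 = 2 * k\<^sup>2" using eq by (simp add: power2_eq_square)
  then have "even n" by (metis dvd_triv_left even_power)
  with \<open>even m\<close> \<open>coprime m n\<close> show False by (auto simp: coprime_def)
qed

lemma bounded_linear_phase_of_modes: "bounded_linear phase_of_modes"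
proof -
  have "linear phase_of_modes"
    by (rule linearI) (auto simp: phase_of_modes_def add_divide_distrib diff_divide_distrib algebra_simps)
  then show ?thesis by (simp add: linear_conv_bounded_linear)
qed

lemma mode_force_C1:
  assumes "smooth F1" "smooth F2"
  obtains D :: "real \<times> complex \<times> complex \<Rightarrow> (real \<times> complex \<times> complex) \<Rightarrow>\<^sub>L complex"
  where "\<And>p. (mode_force c F1 F2 has_derivative blinfun_apply (D p)) (at p)" "continuous_on UNIV D"
proof -
  obtain D1 where D1: "\<And>p. (F1 has_derivative blinfun_apply (D1 p)) (at p)" "continuous_on UNIV D1"
    using smooth_imp_C1[OF assms(1)] by blast
  obtain D2 where D2: "\<And>p. (F2 has_derivative blinfun_apply (D2 p)) (at p)" "continuous_on UNIV D2"
    using smooth_imp_C1[OF assms(2)] by blast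
  define A :: "real \<times> complex \<times> complex \<Rightarrow> real \<times> phase" where "A p = (fst p, phase_of_modes (snd p))" for p
  have A: "bounded_linear A"
    unfolding A_def[abs_def]
    by (intro bounded_linear_Pair bounded_linear_fst bounded_linear_compose[OF bounded_linear_phase_of_modes]
        bounded_linear_snd)
  have A_cont: "continuous_on UNIV A" by (rule linear_continuous_on[OF A])
  define D where "D p = Blinfun complex_of_real o\<^sub>L (c *\<^sub>R D1 (A p) + D2 (A p)) o\<^sub>L Blinfun A" for p
  show ?thesis
  proof
    fix p
    note A_deriv = bounded_linear_imp_has_derivative[OF A]
    have "((\<lambda>p. F1 (A p)) has_derivative (\<lambda>v. D1 (A p) (A v))) (at p)"
      "((\<lambda>p. F2 (A p)) has_derivative (\<lambda>v. D2 (A p) (A v))) (at p)"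
      by (rule has_derivative_compose[OF A_deriv D1(1)], rule has_derivative_compose[OF A_deriv D2(1)])
    then have "((\<lambda>p. complex_of_real (c * F1 (A p) + F2 (A p))) has_derivative
        (\<lambda>v. complex_of_real (c * D1 (A p) (A v) + D2 (A p) (A v)))) (at p)"
      by (intro has_derivative_of_real has_derivative_add has_derivative_mult_right)
    moreover have "blinfun_apply (D p) = (\<lambda>v. complex_of_real (c * D1 (A p) (A v) + D2 (A p) (A v)))"
      by (simp add: D_def fun_eq_iff bounded_linear_Blinfun_apply A bounded_linear_of_real blinfun.bilinear_simps)
    ultimately show "(mode_force c F1 F2 has_derivative blinfun_apply (D p)) (at p)"
      by (simp add: mode_force_def[abs_def] A_def)
  next
    show "continuous_on UNIV D"
      unfolding D_def[abs_def]
      by (intro continuous_intros continuous_on_compose2[OF D1(2) A_cont] continuous_on_compose2[OF D2(2) A_cont]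
          bounded_bilinear.continuous_on[OF bounded_bilinear_blinfun_compose]) auto
  qed
qed

section \<open>The pendulum as an instance of the two-mode system\<close>

locale double_pendulum =
  fixes p :: nat and F1 F2 :: "real \<times> phase \<Rightarrow> real"
  assumes p_pos: "p > 0" and smooth: "smooth F1" "smooth F2"
    and F_per: "\<And>\<tau> x. F1 (\<tau> + real p * T\<^sub>1, x) = F1 (\<tau>, x)" "\<And>\<tau> x. F2 (\<tau> + real p * T\<^sub>1, x) = F2 (\<tau>, x)"
begin

text \<open>Continuous derivatives are fixed by choice because the locale
  \<open>resonant_modes\<close> takes them as parameters.\<close>

definition "D\<^sub>u = (SOME D :: real \<times> complex \<times> complex \<Rightarrow> _ \<Rightarrow>\<^sub>L complex.
  (\<forall>q. (mode_force (sqrt 2) F1 F2 has_derivative blinfun_apply (D q)) (at q)) \<and> continuous_on UNIV D)"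

definition "D\<^sub>w = (SOME D :: real \<times> complex \<times> complex \<Rightarrow> _ \<Rightarrow>\<^sub>L complex.
  (\<forall>q. (mode_force (- sqrt 2) F1 F2 has_derivative blinfun_apply (D q)) (at q)) \<and> continuous_on UNIV D)"

sublocale resonant_modes "real p * T\<^sub>1" \<omega>\<^sub>1 \<omega>\<^sub>2 "mode_force (sqrt 2) F1 F2" "mode_force (- sqrt 2) F1 F2" D\<^sub>u D\<^sub>w
proof
  show "real p * T\<^sub>1 > 0" using p_pos \<omega>_pos by (simp add: T\<^sub>1_def)
  have "\<omega>\<^sub>1 * (real p * T\<^sub>1) = 2 * pi * real p" using \<omega>_pos by (simp add: T\<^sub>1_def)
  then show "cis (\<omega>\<^sub>1 * (real p * T\<^sub>1)) = 1"
    by (simp only: cis_multiple_2pi Ints_of_nat)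
  \<comment> \<open>A resonance would make \<open>p * (1 + sqrt 2)\<close> an integer and
    \<open>sqrt 2\<close> rational.\<close>
  show "cis (\<omega>\<^sub>2 * (real p * T\<^sub>1)) \<noteq> 1"
  proof
    assume "cis (\<omega>\<^sub>2 * (real p * T\<^sub>1)) = 1"
    then have "cos (\<omega>\<^sub>2 * (real p * T\<^sub>1)) = 1" by (simp add: complex_eq_iff)
    then obtain n :: int where "\<omega>\<^sub>2 * (real p * T\<^sub>1) = n * 2 * pi" by (auto simp: cos_one_2pi_int)
    moreover have "\<omega>\<^sub>2 * (real p * T\<^sub>1) = real p * (1 + sqrt 2) * 2 * pi"
      using \<omega>_pos by (simp add: \<omega>\<^sub>2_eq T\<^sub>1_def)
    ultimately have "real p * (1 + sqrt 2) = n" by simp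
    then have "sqrt 2 = of_int n / of_nat p - 1" using p_pos by (simp add: field_simps)
    also have "\<dots> \<in> \<rat>" by simp
    finally show False using sqrt2_irrational by simp
  qed
  have ex: "\<exists>D. (\<forall>q. (mode_force c F1 F2 has_derivative blinfun_apply (D q)) (at q)) \<and> continuous_on UNIV D" for c
    using mode_force_C1[OF smooth, of c] by metis
  show "(mode_force (sqrt 2) F1 F2 has_derivative blinfun_apply (D\<^sub>u q)) (at q)" "continuous_on UNIV D\<^sub>u" for q
    unfolding D\<^sub>u_def using someI_ex[OF ex] by blast+
  show "(mode_force (- sqrt 2) F1 F2 has_derivative blinfun_apply (D\<^sub>w q)) (at q)" "continuous_on UNIV D\<^sub>w" for q
    unfolding D\<^sub>w_def using someI_ex[OF ex] by blast+
qed (simp_all add: mode_force_def F_per)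

end

text \<open>The imaginary parts of the mode equations say that the components at the velocity places
  are the derivatives of the angles; the real parts give the second-order equations, in which the
  combinations of the two forces reduce to \<open>F1\<close> and \<open>F2\<close>.\<close>

lemma pendulum_solution_of_modes:
  assumes \<zeta>1: "\<And>t. ((\<lambda>t. fst (x t)) has_vector_derivative
      \<i> * \<omega>\<^sub>1 * fst (x t) + \<epsilon> *\<^sub>R mode_force (sqrt 2) F1 F2 (t, x t)) (at t)"
    and \<zeta>2: "\<And>t. ((\<lambda>t. snd (x t)) has_vector_derivative
      \<i> * \<omega>\<^sub>2 * snd (x t) + \<epsilon> *\<^sub>R mode_force (- sqrt 2) F1 F2 (t, x t)) (at t)"
  shows "pendulum_solution F1 F2 \<epsilon> (\<lambda>t. fst (phase_of_modes (x t))) (\<lambda>t. fst (snd (snd (phase_of_modes (x t)))))"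
proof -
  have s2: "sqrt 2 * (sqrt 2 * c) = 2 * c" for c :: real by (simp flip: mult.assoc)
  note parts = has_real_derivative_iff_has_vector_derivative
    bounded_linear.has_vector_derivative[OF bounded_linear_Re] bounded_linear.has_vector_derivative[OF bounded_linear_Im]
  define f1 where "f1 t = F1 (t, phase_of_modes (x t))" for t
  define f2 where "f2 t = F2 (t, phase_of_modes (x t))" for t
  have Re1: "((\<lambda>t. Re (fst (x t))) has_real_derivative - \<omega>\<^sub>1 * Im (fst (x t)) + \<epsilon> * (sqrt 2 * f1 t + f2 t)) (at t)" for t
    using parts(2)[OF \<zeta>1] by (simp add: parts(1) mode_force_def f1_def f2_def)
  have Im1: "((\<lambda>t. Im (fst (x t))) has_real_derivative \<omega>\<^sub>1 * Re (fst (x t))) (at t)" for t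
    using parts(3)[OF \<zeta>1] by (simp add: parts(1) mode_force_def)
  have Re2: "((\<lambda>t. Re (snd (x t))) has_real_derivative - \<omega>\<^sub>2 * Im (snd (x t)) + \<epsilon> * (- sqrt 2 * f1 t + f2 t)) (at t)" for t
    using parts(2)[OF \<zeta>2] by (simp add: parts(1) mode_force_def f1_def f2_def)
  have Im2: "((\<lambda>t. Im (snd (x t))) has_real_derivative \<omega>\<^sub>2 * Re (snd (x t))) (at t)" for t
    using parts(3)[OF \<zeta>2] by (simp add: parts(1) mode_force_def)
  \<comment> \<open>In this form \<open>\<omega>\<^sub>1 * Im (fst (x t))\<close> becomes
    \<open>2 - sqrt 2\<close> times the displacement
    \<open>Im (fst (x t)) / \<omega>\<^sub>1\<close>; likewise for the second mode.\<close>
  have \<omega>1: "\<omega>\<^sub>1 = (2 - sqrt 2) / \<omega>\<^sub>1" and \<omega>2: "\<omega>\<^sub>2 = (2 + sqrt 2) / \<omega>\<^sub>2"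
    using \<omega>_square \<omega>_pos by (simp_all add: field_simps)
  have \<theta>1: "((\<lambda>t. (Im (fst (x t)) / \<omega>\<^sub>1 - Im (snd (x t)) / \<omega>\<^sub>2) / (2 * sqrt 2)) has_real_derivative
      (Re (fst (x t)) - Re (snd (x t))) / (2 * sqrt 2)) (at t)" for t
    by (rule DERIV_cong[OF DERIV_cdivide[OF DERIV_diff[OF DERIV_cdivide[OF Im1] DERIV_cdivide[OF Im2]]]])
      (use \<omega>_pos in simp)
  have \<theta>2: "((\<lambda>t. (Im (fst (x t)) / \<omega>\<^sub>1 + Im (snd (x t)) / \<omega>\<^sub>2) / 2) has_real_derivative
      (Re (fst (x t)) + Re (snd (x t))) / 2) (at t)" for t
    by (rule DERIV_cong[OF DERIV_cdivide[OF DERIV_add[OF DERIV_cdivide[OF Im1] DERIV_cdivide[OF Im2]]]])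
      (use \<omega>_pos in simp)
  have v1: "((\<lambda>t. (Re (fst (x t)) - Re (snd (x t))) / (2 * sqrt 2)) has_real_derivative
      - 2 * ((Im (fst (x t)) / \<omega>\<^sub>1 - Im (snd (x t)) / \<omega>\<^sub>2) / (2 * sqrt 2))
      + (Im (fst (x t)) / \<omega>\<^sub>1 + Im (snd (x t)) / \<omega>\<^sub>2) / 2 + \<epsilon> * f1 t) (at t)" for t
  proof -
    have "((\<lambda>t. (Re (fst (x t)) - Re (snd (x t))) / (2 * sqrt 2)) has_real_derivative
      (- \<omega>\<^sub>1 * Im (fst (x t)) + \<epsilon> * (sqrt 2 * f1 t + f2 t)
       - (- \<omega>\<^sub>2 * Im (snd (x t)) + \<epsilon> * (- sqrt 2 * f1 t + f2 t))) / (2 * sqrt 2)) (at t)"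
      by (intro DERIV_cdivide DERIV_diff Re1 Re2)
    moreover have "(- \<omega>\<^sub>1 * a + \<epsilon> * (sqrt 2 * g + h) - (- \<omega>\<^sub>2 * b + \<epsilon> * (- sqrt 2 * g + h))) / (2 * sqrt 2)
       = - 2 * ((a / \<omega>\<^sub>1 - b / \<omega>\<^sub>2) / (2 * sqrt 2)) + (a / \<omega>\<^sub>1 + b / \<omega>\<^sub>2) / 2 + \<epsilon> * g" for a b g h
    proof -
      have "(- \<omega>\<^sub>1 * a + \<epsilon> * (sqrt 2 * g + h) - (- \<omega>\<^sub>2 * b + \<epsilon> * (- sqrt 2 * g + h))) / (2 * sqrt 2)
        = (- ((2 - sqrt 2) * (a / \<omega>\<^sub>1)) + (2 + sqrt 2) * (b / \<omega>\<^sub>2)) / (2 * sqrt 2) + \<epsilon> * g"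
        by (subst \<omega>1, subst \<omega>2) (simp add: field_simps)
      also have "(- ((2 - sqrt 2) * u) + (2 + sqrt 2) * w) / (2 * sqrt 2)
        = - 2 * ((u - w) / (2 * sqrt 2)) + (u + w) / 2" for u w :: real
        by (simp add: field_simps s2)
      finally show ?thesis by simp
    qed
    ultimately show ?thesis by (simp only:)
  qed
  have v2: "((\<lambda>t. (Re (fst (x t)) + Re (snd (x t))) / 2) has_real_derivative
      2 * ((Im (fst (x t)) / \<omega>\<^sub>1 - Im (snd (x t)) / \<omega>\<^sub>2) / (2 * sqrt 2))
      - 2 * ((Im (fst (x t)) / \<omega>\<^sub>1 + Im (snd (x t)) / \<omega>\<^sub>2) / 2) + \<epsilon> * f2 t) (at t)" for t
  proof -
    have "((\<lambda>t. (Re (fst (x t)) + Re (snd (x t))) / 2) has_real_derivative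
      (- \<omega>\<^sub>1 * Im (fst (x t)) + \<epsilon> * (sqrt 2 * f1 t + f2 t)
       + (- \<omega>\<^sub>2 * Im (snd (x t)) + \<epsilon> * (- sqrt 2 * f1 t + f2 t))) / 2) (at t)"
      by (intro DERIV_cdivide DERIV_add Re1 Re2)
    moreover have "(- \<omega>\<^sub>1 * a + \<epsilon> * (sqrt 2 * g + h) + (- \<omega>\<^sub>2 * b + \<epsilon> * (- sqrt 2 * g + h))) / 2
       = 2 * ((a / \<omega>\<^sub>1 - b / \<omega>\<^sub>2) / (2 * sqrt 2)) - 2 * ((a / \<omega>\<^sub>1 + b / \<omega>\<^sub>2) / 2) + \<epsilon> * h" for a b g h
    proof -
      have "(- \<omega>\<^sub>1 * a + \<epsilon> * (sqrt 2 * g + h) + (- \<omega>\<^sub>2 * b + \<epsilon> * (- sqrt 2 * g + h))) / 2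
        = (- ((2 - sqrt 2) * (a / \<omega>\<^sub>1)) - (2 + sqrt 2) * (b / \<omega>\<^sub>2)) / 2 + \<epsilon> * h"
        by (subst \<omega>1, subst \<omega>2) (simp add: field_simps)
      also have "(- ((2 - sqrt 2) * u) - (2 + sqrt 2) * w) / 2
        = 2 * ((u - w) / (2 * sqrt 2)) - 2 * ((u + w) / 2)" for u w :: real
        by (simp add: field_simps s2)
      finally show ?thesis by simp
    qed
    ultimately show ?thesis by (simp only:)
  qed
  show ?thesis
    unfolding pendulum_solution_def
  proof (intro exI allI conjI)
    fix t
    show "((\<lambda>t. fst (phase_of_modes (x t))) has_real_derivative
        (Re (fst (x t)) - Re (snd (x t))) / (2 * sqrt 2)) (at t)"
      using \<theta>1 by (simp add: phase_of_modes_def)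
    show "((\<lambda>t. fst (snd (snd (phase_of_modes (x t))))) has_real_derivative
        (Re (fst (x t)) + Re (snd (x t))) / 2) (at t)"
      using \<theta>2 by (simp add: phase_of_modes_def)
  qed (use v1 v2 in \<open>simp_all add: phase_of_modes_def f1_def f2_def\<close>)
qed

section \<open>The averaged equations and their simple zeros\<close>

context double_pendulum begin

text \<open>Multiplying \<open>2 * Y + 2 * \<i> * X\<close> by
  \<open>cis (\<omega>\<^sub>1 * t)\<close> gives the velocity as real part and the displacement as
  imaginary part; the factor 2 cancels the halves in \<open>phase_of_modes\<close>.\<close>

lemma phase_of_modes_orbit:
  "phase_of_modes (orbit (Complex (2 * Y) (2 * X)) t) = (A\<^sub>1 X Y t, B\<^sub>1 X Y t, C\<^sub>1 X Y t, D\<^sub>1 X Y t)"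
  unfolding A\<^sub>1_def B\<^sub>1_def C\<^sub>1_def D\<^sub>1_def sqrt_4 \<omega>\<^sub>1_def[symmetric]
  by (simp add: phase_of_modes_def orbit_def add_divide_distrib diff_divide_distrib mult_ac)

text \<open>Since \<open>cis (- s) = cos s - \<i> * sin s\<close>, the real part of the Fourier
  coefficient is the cosine integral and the imaginary part is minus the sine integral.\<close>

lemma resonance_orbit:
  "resonance (orbit (Complex (2 * Y) (2 * X))) = Complex (\<G>\<^sub>2 F1 F2 p X Y) (- \<G>\<^sub>1 F1 F2 p X Y)"
proof -
  let ?x = "orbit (Complex (2 * Y) (2 * X))"
  let ?f = "\<lambda>s. cis (- (\<omega>\<^sub>1 * s)) * mode_force (sqrt 2) F1 F2 (s, ?x s)"
  have f: "?f s = cis (- (\<omega>\<^sub>1 * s)) * of_real (sqrt 2 * along F1 X Y s + along F2 X Y s)" for s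
    by (simp add: mode_force_def phase_of_modes_orbit along_def)
  have int: "?f integrable_on {0..real p * T\<^sub>1}"
    by (intro integrable_continuous_real continuous_on_resonance_integrand continuous_on_orbit)
  have "Re (resonance ?x) = \<G>\<^sub>2 F1 F2 p X Y"
    using integral_linear[OF int bounded_linear_Re]
    by (simp add: resonance_def \<G>\<^sub>2_def f o_def)
  moreover have "Im (resonance ?x) = - \<G>\<^sub>1 F1 F2 p X Y"
    using integral_linear[OF int bounded_linear_Im]
    by (simp add: resonance_def \<G>\<^sub>1_def f o_def)
  ultimately show ?thesis by (simp add: complex_eq_iff)
qed

text \<open>In suitable linear coordinates the map with components \<open>\<G>\<^sub>1\<close> and
  \<open>\<G>\<^sub>2\<close> is the resonance of the orbit, so a nonzero Jacobian determinant is
  injectivity of the derivative of the resonance.\<close>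

lemma simple_zero_nondegenerate:
  assumes "simple_zero (\<G>\<^sub>1 F1 F2 p) (\<G>\<^sub>2 F1 F2 p) X Y"
  shows "resonance (orbit (Complex (2 * Y) (2 * X))) = 0"
    and "inj (resonance_deriv (Complex (2 * Y) (2 * X)))"
proof -
  let ?z = "Complex (2 * Y) (2 * X)"
  show "resonance (orbit ?z) = 0"
    using assms by (simp add: resonance_orbit simple_zero_def Complex_eq_0)
  \<comment> \<open>\<open>V\<close> turns the complex number
    \<open>\<G>\<^sub>2 - \<i> * \<G>\<^sub>1\<close> into the vector of \<open>\<G>\<^sub>1\<close>
    and \<open>\<G>\<^sub>2\<close>; \<open>J\<close>, defined next, turns the coordinates
    \<open>X\<close>, \<open>Y\<close> into the initial mode.\<close>
  define V :: "complex \<Rightarrow> real^2" where "V c = vector [- Im c, Re c]" for c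
  define J :: "real^2 \<Rightarrow> complex" where "J v = Complex (2 * v $ 2) (2 * v $ 1)" for v
  let ?f = "\<lambda>v :: real^2. vector [\<G>\<^sub>1 F1 F2 p (v $ 1) (v $ 2), \<G>\<^sub>2 F1 F2 p (v $ 1) (v $ 2)] :: real^2"
  let ?g = "\<lambda>v. V (resonance_deriv ?z (J v))"
  have lin: "linear V" "linear J"
    by (auto intro!: linearI simp: V_def J_def vec_eq_iff forall_2 complex_eq_iff algebra_simps)
  have f_eq: "?f v = V (resonance (orbit (J v)))" for v
    by (simp add: J_def V_def resonance_orbit)
  have J_z: "J (vector [X, Y]) = ?z" by (simp add: J_def)
  have "(J has_derivative J) (at (vector [X, Y]))" "(V has_derivative V) (at c)" for c
    using lin by (auto simp: linear_conv_bounded_linear intro: bounded_linear_imp_has_derivative)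
  note derivs = this
  have "((\<lambda>v. resonance (orbit (J v))) has_derivative (\<lambda>v. resonance_deriv ?z (J v))) (at (vector [X, Y]))"
    using has_derivative_compose[OF derivs(1), of "\<lambda>z. resonance (orbit z)"] resonance_has_derivative[of ?z]
    by (simp add: J_z)
  from has_derivative_compose[OF this derivs(2)]
  have "(?f has_derivative ?g) (at (vector [X, Y]))" by (simp add: f_eq)
  then have "det (matrix ?g) \<noteq> 0"
    using assms frechet_derivative_at by (fastforce simp: simple_zero_def jacobian_def)
  moreover have "linear ?g"
    using linear_compose[OF linear_compose[OF lin(2) linear_resonance_deriv] lin(1)] by (simp add: o_def)
  ultimately have inj_g: "inj ?g" by (simp add: det_nz_iff_inj)
  \<comment> \<open>Surjectivity of \<open>J\<close> passes injectivity from the composition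
    \<open>?g\<close> to its middle factor.\<close>
  have J_surj: "\<exists>v. J v = c" for c
    by (rule exI[of _ "vector [Im c / 2, Re c / 2]"]) (simp add: J_def)
  show "inj (resonance_deriv ?z)"
  proof (rule injI)
    fix c d assume eq: "resonance_deriv ?z c = resonance_deriv ?z d"
    obtain v w where "J v = c" "J w = d" using J_surj by metis
    with eq injD[OF inj_g, of v w] show "c = d" by simp
  qed
qed

text \<open>\<open>phase_of_modes\<close> is linear and bounded, so the estimate for the modes
  carries over to the angles. Here the bound on \<epsilon> still depends on the zero.\<close>

lemma ex_periodic_solution:
  assumes "simple_zero (\<G>\<^sub>1 F1 F2 p) (\<G>\<^sub>2 F1 F2 p) X Y"
  obtains \<epsilon>0 C where "\<epsilon>0 > 0"
    "\<And>\<epsilon>. \<bar>\<epsilon>\<bar> < \<epsilon>0 \<Longrightarrow> \<exists>\<theta>1 \<theta>2. periodic_pendulum_solution F1 F2 \<epsilon> (real p * T\<^sub>1) \<theta>1 \<theta>2 \<and>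
       (\<forall>\<tau>. \<bar>\<theta>1 \<tau> - A\<^sub>1 X Y \<tau>\<bar> \<le> C * sqrt \<bar>\<epsilon>\<bar> \<and> \<bar>\<theta>2 \<tau> - C\<^sub>1 X Y \<tau>\<bar> \<le> C * sqrt \<bar>\<epsilon>\<bar>)"
proof -
  let ?z = "Complex (2 * Y) (2 * X)"
  obtain C \<epsilon>0 where C: "\<epsilon>0 > 0"
    "\<And>\<epsilon>. \<bar>\<epsilon>\<bar> < \<epsilon>0 \<Longrightarrow> \<exists>x. mode_solution \<epsilon> x \<and> (\<forall>t. norm (x t - orbit ?z t) \<le> C * sqrt \<bar>\<epsilon>\<bar>)"
    using ex_mode_solution[OF simple_zero_nondegenerate(2,1)[OF assms]] by metis
  obtain K where K: "K > 0" "\<And>x. norm (phase_of_modes x) \<le> norm x * K"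
    using bounded_linear.pos_bounded[OF bounded_linear_phase_of_modes] by blast
  show ?thesis
  proof (rule that[OF C(1)])
    fix \<epsilon> :: real assume "\<bar>\<epsilon>\<bar> < \<epsilon>0"
    then obtain x where x: "mode_solution \<epsilon> x" "\<And>t. norm (x t - orbit ?z t) \<le> C * sqrt \<bar>\<epsilon>\<bar>"
      using C(2) by blast
    let ?y = "\<lambda>t. phase_of_modes (x t)"
    have "pendulum_solution F1 F2 \<epsilon> (\<lambda>t. fst (?y t)) (\<lambda>t. fst (snd (snd (?y t))))"
      using x(1) by (intro pendulum_solution_of_modes) (auto simp: mode_solution_def)
    then have "periodic_pendulum_solution F1 F2 \<epsilon> (real p * T\<^sub>1) (\<lambda>t. fst (?y t)) (\<lambda>t. fst (snd (snd (?y t))))"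
      using x(1) by (simp add: periodic_pendulum_solution_def mode_solution_def)
    moreover have "\<bar>fst (?y t) - A\<^sub>1 X Y t\<bar> \<le> K * C * sqrt \<bar>\<epsilon>\<bar>"
      "\<bar>fst (snd (snd (?y t))) - C\<^sub>1 X Y t\<bar> \<le> K * C * sqrt \<bar>\<epsilon>\<bar>" for t
    proof -
      have "norm (?y t - phase_of_modes (orbit ?z t)) \<le> norm (x t - orbit ?z t) * K"
        using K(2) by (simp add: linear_diff[OF bounded_linear.linear[OF bounded_linear_phase_of_modes], symmetric])
      also have "\<dots> \<le> C * sqrt \<bar>\<epsilon>\<bar> * K" using x(2) K(1) by (intro mult_right_mono) auto
      finally have le: "norm (?y t - phase_of_modes (orbit ?z t)) \<le> K * C * sqrt \<bar>\<epsilon>\<bar>" by (simp add: mult_ac)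
      show "\<bar>fst (?y t) - A\<^sub>1 X Y t\<bar> \<le> K * C * sqrt \<bar>\<epsilon>\<bar>"
        using order_trans[OF dist_fst_le le[folded dist_norm]] by (simp add: phase_of_modes_orbit dist_norm)
      show "\<bar>fst (snd (snd (?y t))) - C\<^sub>1 X Y t\<bar> \<le> K * C * sqrt \<bar>\<epsilon>\<bar>"
        using order_trans[OF dist_fst_le order_trans[OF dist_snd_le order_trans[OF dist_snd_le le[folded dist_norm]]]]
        by (simp add: phase_of_modes_orbit dist_norm)
    qed
    ultimately show "\<exists>\<theta>1 \<theta>2. periodic_pendulum_solution F1 F2 \<epsilon> (real p * T\<^sub>1) \<theta>1 \<theta>2 \<and>
       (\<forall>\<tau>. \<bar>\<theta>1 \<tau> - A\<^sub>1 X Y \<tau>\<bar> \<le> K * C * sqrt \<bar>\<epsilon>\<bar> \<and> \<bar>\<theta>2 \<tau> - C\<^sub>1 X Y \<tau>\<bar> \<le> K * C * sqrt \<bar>\<epsilon>\<bar>)"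
      by blast
  qed
qed

text \<open>An orbit solves the mode equations with \<epsilon> equal to 0, and its period is
  \<open>T\<^sub>1\<close> because \<open>\<omega>\<^sub>1 * T\<^sub>1 = 2 * pi\<close>.\<close>

lemma unperturbed_solution: "periodic_pendulum_solution F1 F2 0 T\<^sub>1 (A\<^sub>1 X Y) (C\<^sub>1 X Y)"
proof -
  let ?x = "orbit (Complex (2 * Y) (2 * X))"
  have "((\<lambda>t. fst (?x t)) has_vector_derivative \<i> * \<omega>\<^sub>1 * fst (?x t)) (at t)" for t
    using has_vector_derivative_mult_left[OF cis_has_vector_derivative] by (simp add: orbit_def mult.assoc)
  then have "pendulum_solution F1 F2 0 (\<lambda>t. fst (phase_of_modes (?x t))) (\<lambda>t. fst (snd (snd (phase_of_modes (?x t)))))"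
    by (intro pendulum_solution_of_modes) (simp_all add: orbit_def)
  moreover have "\<omega>\<^sub>1 * (t + T\<^sub>1) = \<omega>\<^sub>1 * t + 2 * pi" for t
    using \<omega>_pos by (simp add: T\<^sub>1_def distrib_left)
  ultimately show ?thesis
    by (simp add: periodic_pendulum_solution_def phase_of_modes_orbit A\<^sub>1_def[abs_def] C\<^sub>1_def[abs_def])
qed

text \<open>Solutions close to the given zero are taken when
  \<open>\<bar>\<epsilon>\<bar> < \<epsilon>1\<close>, those of \<open>base\<close> otherwise. The
  limit only sees the former, so \<open>\<epsilon>0\<close> may be fixed before the zero.\<close>

lemma ex_periodic_family:
  assumes zero: "simple_zero (\<G>\<^sub>1 F1 F2 p) (\<G>\<^sub>2 F1 F2 p) X Y"
    and base: "\<And>\<epsilon>. \<bar>\<epsilon>\<bar> < \<epsilon>0 \<Longrightarrow> \<exists>\<theta>1 \<theta>2. periodic_pendulum_solution F1 F2 \<epsilon> (real p * T\<^sub>1) \<theta>1 \<theta>2"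
  shows "\<exists>\<theta>1 \<theta>2 :: real \<Rightarrow> real \<Rightarrow> real.
    (\<forall>\<epsilon>. 0 < \<bar>\<epsilon>\<bar> \<and> \<bar>\<epsilon>\<bar> < \<epsilon>0 \<longrightarrow>
       periodic_pendulum_solution F1 F2 \<epsilon> (real p * T\<^sub>1) (\<lambda>\<tau>. \<theta>1 \<tau> \<epsilon>) (\<lambda>\<tau>. \<theta>2 \<tau> \<epsilon>)) \<and>
    (\<forall>\<tau>. ((\<lambda>\<epsilon>. \<theta>1 \<tau> \<epsilon>) \<longlongrightarrow> A\<^sub>1 X Y \<tau>) (at 0) \<and> ((\<lambda>\<epsilon>. \<theta>2 \<tau> \<epsilon>) \<longlongrightarrow> C\<^sub>1 X Y \<tau>) (at 0))"
proof -
  obtain \<epsilon>1 C where \<epsilon>1: "\<epsilon>1 > 0" and near: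
    "\<And>\<epsilon>. \<bar>\<epsilon>\<bar> < \<epsilon>1 \<Longrightarrow> \<exists>\<theta>1 \<theta>2. periodic_pendulum_solution F1 F2 \<epsilon> (real p * T\<^sub>1) \<theta>1 \<theta>2 \<and>
       (\<forall>\<tau>. \<bar>\<theta>1 \<tau> - A\<^sub>1 X Y \<tau>\<bar> \<le> C * sqrt \<bar>\<epsilon>\<bar> \<and> \<bar>\<theta>2 \<tau> - C\<^sub>1 X Y \<tau>\<bar> \<le> C * sqrt \<bar>\<epsilon>\<bar>)"
    using ex_periodic_solution[OF zero] by metis
  have "\<exists>\<theta>1 \<theta>2. (\<bar>\<epsilon>\<bar> < \<epsilon>0 \<longrightarrow> periodic_pendulum_solution F1 F2 \<epsilon> (real p * T\<^sub>1) \<theta>1 \<theta>2) \<and>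
      (\<bar>\<epsilon>\<bar> < \<epsilon>1 \<longrightarrow> (\<forall>\<tau>. \<bar>\<theta>1 \<tau> - A\<^sub>1 X Y \<tau>\<bar> \<le> C * sqrt \<bar>\<epsilon>\<bar> \<and> \<bar>\<theta>2 \<tau> - C\<^sub>1 X Y \<tau>\<bar> \<le> C * sqrt \<bar>\<epsilon>\<bar>))" for \<epsilon>
  proof (cases "\<bar>\<epsilon>\<bar> < \<epsilon>1")
    case True
    then show ?thesis using near[of \<epsilon>] by blast
  next
    case False
    then show ?thesis using base[of \<epsilon>] by blast
  qed
  then obtain \<theta>1 \<theta>2 where
    sol: "\<And>\<epsilon>. \<bar>\<epsilon>\<bar> < \<epsilon>0 \<Longrightarrow> periodic_pendulum_solution F1 F2 \<epsilon> (real p * T\<^sub>1) (\<theta>1 \<epsilon>) (\<theta>2 \<epsilon>)" and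
    le: "\<And>\<epsilon> \<tau>. \<bar>\<epsilon>\<bar> < \<epsilon>1 \<Longrightarrow> \<bar>\<theta>1 \<epsilon> \<tau> - A\<^sub>1 X Y \<tau>\<bar> \<le> C * sqrt \<bar>\<epsilon>\<bar>"
      "\<And>\<epsilon> \<tau>. \<bar>\<epsilon>\<bar> < \<epsilon>1 \<Longrightarrow> \<bar>\<theta>2 \<epsilon> \<tau> - C\<^sub>1 X Y \<tau>\<bar> \<le> C * sqrt \<bar>\<epsilon>\<bar>"
    by metis
  have lim: "((\<lambda>\<epsilon>. \<theta> \<epsilon> \<tau>) \<longlongrightarrow> u) (at 0)"
    if "\<And>\<epsilon>. \<bar>\<epsilon>\<bar> < \<epsilon>1 \<Longrightarrow> \<bar>\<theta> \<epsilon> \<tau> - u\<bar> \<le> C * sqrt \<bar>\<epsilon>\<bar>" for \<theta> :: "real \<Rightarrow> real \<Rightarrow> real" and \<tau> u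
  proof (rule LIM_zero_cancel, rule Lim_null_comparison)
    show "\<forall>\<^sub>F \<epsilon> in at 0. norm (\<theta> \<epsilon> \<tau> - u) \<le> C * sqrt \<bar>\<epsilon>\<bar>"
      unfolding eventually_at using \<epsilon>1 that by (intro exI[of _ \<epsilon>1]) (auto simp: dist_norm)
    have "((\<lambda>\<epsilon>. C * sqrt \<bar>\<epsilon>\<bar>) \<longlongrightarrow> C * sqrt \<bar>0\<bar>) (at 0)" by (intro tendsto_intros)
    then show "((\<lambda>\<epsilon>. C * sqrt \<bar>\<epsilon>\<bar>) \<longlongrightarrow> 0) (at 0)" by simp
  qed
  show ?thesis
    by (intro exI[of _ "\<lambda>\<tau> \<epsilon>. \<theta>1 \<epsilon> \<tau>"] exI[of _ "\<lambda>\<tau> \<epsilon>. \<theta>2 \<epsilon> \<tau>"] conjI allI impI lim le)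
      (auto intro: sol)
qed

end

theorem theorem1:
  fixes p q :: nat and F1 F2 :: "real \<times> phase \<Rightarrow> real"
  assumes "p > 0" and "q > 0" and "coprime p q"
    and "smooth F1" and "smooth F2"
    and "\<And>\<tau> x. F1 (\<tau> + real p * T\<^sub>1 / real q, x) = F1 (\<tau>, x)"
    and "\<And>\<tau> x. F2 (\<tau> + real p * T\<^sub>1 / real q, x) = F2 (\<tau>, x)"
  shows "\<exists>\<epsilon>\<^sub>0 > 0. \<forall>X Y.
    simple_zero (\<G>\<^sub>1 F1 F2 p) (\<G>\<^sub>2 F1 F2 p) X Y \<and> (X, Y) \<noteq> (0, 0) \<longrightarrow>
    (let u1 = (\<lambda>\<tau>. 1 / sqrt (4 - 2 * sqrt 2) * (X * cos (\<omega>\<^sub>1 * \<tau>) + Y * sin (\<omega>\<^sub>1 * \<tau>)));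
         u2 = (\<lambda>\<tau>. 1 / sqrt (2 - sqrt 2) * (X * cos (\<omega>\<^sub>1 * \<tau>) + Y * sin (\<omega>\<^sub>1 * \<tau>)))
     in periodic_pendulum_solution F1 F2 0 T\<^sub>1 u1 u2 \<and>
        (\<exists>\<theta>1 \<theta>2 :: real \<Rightarrow> real \<Rightarrow> real.
          (\<forall>\<epsilon>. 0 < \<bar>\<epsilon>\<bar> \<and> \<bar>\<epsilon>\<bar> < \<epsilon>\<^sub>0 \<longrightarrow>
             periodic_pendulum_solution F1 F2 \<epsilon> (real p * T\<^sub>1) (\<lambda>\<tau>. \<theta>1 \<tau> \<epsilon>) (\<lambda>\<tau>. \<theta>2 \<tau> \<epsilon>)) \<and>
          (\<forall>\<tau>. ((\<lambda>\<epsilon>. \<theta>1 \<tau> \<epsilon>) \<longlongrightarrow> u1 \<tau>) (at 0) \<and> ((\<lambda>\<epsilon>. \<theta>2 \<tau> \<epsilon>) \<longlongrightarrow> u2 \<tau>) (at 0))))"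
proof -
  \<comment> \<open>\<open>q\<close> periods of the forcing make up \<open>p\<close> periods of the
    unperturbed motion.\<close>
  have per: "F (\<tau> + real p * T\<^sub>1, x) = F (\<tau>, x)"
    if "\<And>\<tau> x. F (\<tau> + real p * T\<^sub>1 / real q, x) = F (\<tau>, x)" for F :: "real \<times> phase \<Rightarrow> real" and \<tau> x
    using periodic_int_shift[of "\<lambda>\<tau>. F (\<tau>, x)" "real p * T\<^sub>1 / real q" \<tau> "int q"] that \<open>q > 0\<close> by simp
  interpret double_pendulum p F1 F2
    by unfold_locales (use assms per in auto)
  let ?zero = "simple_zero (\<G>\<^sub>1 F1 F2 p) (\<G>\<^sub>2 F1 F2 p)"
  obtain \<epsilon>0 where \<epsilon>0: "\<epsilon>0 > 0" "\<And>X Y \<epsilon>. ?zero X Y \<Longrightarrow> \<bar>\<epsilon>\<bar> < \<epsilon>0 \<Longrightarrow>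
      \<exists>\<theta>1 \<theta>2. periodic_pendulum_solution F1 F2 \<epsilon> (real p * T\<^sub>1) \<theta>1 \<theta>2"
  \<comment> \<open>One arbitrary simple zero supplies \<open>\<epsilon>0\<close> for all of them;
    if there is none, the claim is vacuous and 1 is a dummy value.\<close>
  proof (cases "\<exists>X Y. ?zero X Y")
    case True
    then obtain X Y where XY: "?zero X Y" by blast
    obtain \<epsilon>0 C where \<epsilon>0: "\<epsilon>0 > 0" "\<And>\<epsilon>. \<bar>\<epsilon>\<bar> < \<epsilon>0 \<Longrightarrow> \<exists>\<theta>1 \<theta>2. periodic_pendulum_solution F1 F2 \<epsilon> (real p * T\<^sub>1) \<theta>1 \<theta>2 \<and>
       (\<forall>\<tau>. \<bar>\<theta>1 \<tau> - A\<^sub>1 X Y \<tau>\<bar> \<le> C * sqrt \<bar>\<epsilon>\<bar> \<and> \<bar>\<theta>2 \<tau> - C\<^sub>1 X Y \<tau>\<bar> \<le> C * sqrt \<bar>\<epsilon>\<bar>)"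
      using ex_periodic_solution[OF XY] by metis
    then show ?thesis using that by blast
  next
    case False
    then show ?thesis using that[of 1] by auto
  qed
  have "periodic_pendulum_solution F1 F2 0 T\<^sub>1 (A\<^sub>1 X Y) (C\<^sub>1 X Y) \<and>
      (\<exists>\<theta>1 \<theta>2 :: real \<Rightarrow> real \<Rightarrow> real.
        (\<forall>\<epsilon>. 0 < \<bar>\<epsilon>\<bar> \<and> \<bar>\<epsilon>\<bar> < \<epsilon>0 \<longrightarrow>
           periodic_pendulum_solution F1 F2 \<epsilon> (real p * T\<^sub>1) (\<lambda>\<tau>. \<theta>1 \<tau> \<epsilon>) (\<lambda>\<tau>. \<theta>2 \<tau> \<epsilon>)) \<and>
        (\<forall>\<tau>. ((\<lambda>\<epsilon>. \<theta>1 \<tau> \<epsilon>) \<longlongrightarrow> A\<^sub>1 X Y \<tau>) (at 0) \<and> ((\<lambda>\<epsilon>. \<theta>2 \<tau> \<epsilon>) \<longlongrightarrow> C\<^sub>1 X Y \<tau>) (at 0)))"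
    if "?zero X Y" for X Y
    using unperturbed_solution ex_periodic_family[OF that \<epsilon>0(2)[OF that]] by blast
  then show ?thesis
    using \<epsilon>0(1) unfolding Let_def A\<^sub>1_def[abs_def] C\<^sub>1_def[abs_def] by blast
qed

end
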